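(* Let $\mathcal H$ denote either the Hardy space $H^2(\mathbb D)$ or a weighted Bergman space $A^2_\alpha(\mathbb D)$ with $\alpha>-1$. Suppose $\varphi$ and $\psi$ are linear-fractional self-maps of $\mathbb D$, neither of which is an automorphism of $\mathbb D$, such that for some $\zeta\in\partial\mathbb D$ we have $\varphi(\zeta)=\psi(\zeta)\in\partial\mathbb D$ and $\varphi'(\zeta)=\psi'(\zeta)$. If $\varphi\neq\psi$, then $C_\varphi-C_\psi$ is not compact on $\mathcal H$.
   Context: $\mathbb D$ is the open unit disk in $\mathbb C$. For an analytic map $\varphi:\mathbb D\to\mathbb D$, the composition operator is $C_\varphi f=f\circ\varphi$. $H^2(\mathbb D)$ is the space of analytic $f$ on $\mathbb D$ with $\|f\|^2=\lim_{r\to1^-}\int_0^{2\pi}|f(re^{i\theta})|^2\frac{d\theta}{2\pi}<\infty$; for $\alpha>-1$, $A^2_\alpha(\mathbb D)$ is the space of analytic $f$ on $\mathbb D$ with $\|f\|_\alpha^2=(\alpha+1)\int_{\mathbb D}|f(z)|^2(1-|z|^2)^\alpha\,dA(z)<\infty$, $dA$ normalized area measure. A linear-fractional self-map of $\mathbb D$ is a map $z\mapsto (az+b)/(cz+d)$ with $ad-bc\neq0$ mapping $\mathbb D$ into $\mathbb D$; such maps are analytic on a neighborhood of $\overline{\mathbb D}$. *)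

theory Defs
  imports "HOL-Analysis.Analysis"
begin

definition hardy_mean :: "(complex \<Rightarrow> complex) \<Rightarrow> real \<Rightarrow> real" where
  "hardy_mean f r = integral {0..2*pi} (\<lambda>t. (cmod (f (of_real r * cis t)))\<^sup>2) / (2*pi)"

definition in_H2 :: "(complex \<Rightarrow> complex) \<Rightarrow> bool" where
  "in_H2 f \<longleftrightarrow> f holomorphic_on ball 0 1 \<and> (\<exists>L. (hardy_mean f \<longlongrightarrow> L) (at_left 1))"

definition H2_norm :: "(complex \<Rightarrow> complex) \<Rightarrow> real" where
  "H2_norm f = sqrt (Lim (at_left 1) (hardy_mean f))"

section \<open>Weighted Bergman space A^2_alpha (dA = Lebesgue area measure / pi)\<close>

definition bergman_weight_fun :: "real \<Rightarrow> (complex \<Rightarrow> complex) \<Rightarrow> complex \<Rightarrow> real" where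
  "bergman_weight_fun \<alpha> f z = (cmod (f z))\<^sup>2 * (1 - (cmod z)\<^sup>2) powr \<alpha>"

definition in_A2 :: "real \<Rightarrow> (complex \<Rightarrow> complex) \<Rightarrow> bool" where
  "in_A2 \<alpha> f \<longleftrightarrow> f holomorphic_on ball 0 1 \<and>
      set_integrable lborel (ball 0 1) (bergman_weight_fun \<alpha> f)"

definition A2_norm :: "real \<Rightarrow> (complex \<Rightarrow> complex) \<Rightarrow> real" where
  "A2_norm \<alpha> f = sqrt ((\<alpha> + 1) / pi * (LINT z:ball 0 1|lborel. bergman_weight_fun \<alpha> f z))"

definition compact_op_on ::
  "((complex \<Rightarrow> complex) \<Rightarrow> bool) \<Rightarrow> ((complex \<Rightarrow> complex) \<Rightarrow> real)
    \<Rightarrow> ((complex \<Rightarrow> complex) \<Rightarrow> (complex \<Rightarrow> complex)) \<Rightarrow> bool" where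
  "compact_op_on mem nrm T \<longleftrightarrow>
     (\<forall>f. mem f \<longrightarrow> mem (T f)) \<and>
     (\<forall>fs :: nat \<Rightarrow> complex \<Rightarrow> complex. (\<forall>n. mem (fs n) \<and> nrm (fs n) \<le> 1) \<longrightarrow>
        (\<exists>r g. strict_mono r \<and> mem g \<and> (\<lambda>k. nrm (T (fs (r k)) - g)) \<longlonglongrightarrow> 0))"

definition comp_op :: "(complex \<Rightarrow> complex) \<Rightarrow> (complex \<Rightarrow> complex) \<Rightarrow> (complex \<Rightarrow> complex)" where
  "comp_op \<phi> f = f \<circ> \<phi>"

definition lf_selfmap :: "(complex \<Rightarrow> complex) \<Rightarrow> bool" where
  "lf_selfmap \<phi> \<longleftrightarrow> (\<exists>a b c d. a * d - b * c \<noteq> 0 \<and>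
       (\<forall>z. \<phi> z = (a * z + b) / (c * z + d))) \<and> \<phi> ` ball 0 1 \<subseteq> ball 0 1"

definition disc_automorphism :: "(complex \<Rightarrow> complex) \<Rightarrow> bool" where
  "disc_automorphism \<phi> \<longleftrightarrow> \<phi> holomorphic_on ball 0 1 \<and> bij_betw \<phi> (ball 0 1) (ball 0 1)"

end

theory Submission
  imports Defs "HOL-Complex_Analysis.Complex_Analysis"
begin

text \<open>In terms of the Taylor coefficients \<open>a\<^sub>n\<close> the squared norms of all the spaces are
  \<open>\<Sum> \<bar>a\<^sub>n\<bar>\<^sup>2 n! / (\<gamma> (\<gamma> + 1) \<dots> (\<gamma> + n - 1))\<close>, with \<open>\<gamma> = 1\<close> for the Hardy space and \<open>\<gamma> = \<alpha> + 2\<close> for the Bergman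
  spaces, and the reproducing kernel is \<open>(1 - cnj v z) powr -\<gamma>\<close>.

  Under Cayley transforms sending \<open>\<zeta>\<close> and \<open>\<phi> \<zeta>\<close> to infinity, the two maps become the affine self-maps
  \<open>u \<mapsto> s u + a\<close> and \<open>u \<mapsto> s u + b\<close> of the right half-plane, with the same \<open>s > 0\<close> because the derivatives at
  \<open>\<zeta>\<close> agree, and with \<open>a \<noteq> b\<close>. Let \<open>w\<close> tend to \<open>\<zeta>\<close> along the horocycle \<open>Re u = 1\<close>. Then \<open>\<phi> w\<close> and \<open>\<psi> w\<close> stay at a
  constant positive pseudohyperbolic distance, and \<open>1 - \<bar>\<phi> w\<bar>\<^sup>2\<close> and \<open>1 - \<bar>\<psi> w\<bar>\<^sup>2\<close> are \<open>O(1 - \<bar>w\<bar>\<^sup>2)\<close>. The normalised kernels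
  at \<open>\<phi> w\<close> and at \<open>\<psi> w\<close> tend to zero pointwise, but for one of the two, \<open>f\<close> say, the value of \<open>f \<circ> \<phi> - f \<circ> \<psi>\<close> at \<open>w\<close> is
  comparable to the norm of the point evaluation at \<open>w\<close>; hence no subsequence of the images can converge in norm.\<close>

section \<open>Power series on the unit disc\<close>

definition disc_series :: "(nat \<Rightarrow> complex) \<Rightarrow> (complex \<Rightarrow> complex) \<Rightarrow> bool" where
  "disc_series a f \<longleftrightarrow> (\<forall>z. cmod z < 1 \<longrightarrow> (\<lambda>n. a n * z ^ n) sums f z)"

lemma disc_series_sums: "disc_series a f \<Longrightarrow> cmod z < 1 \<Longrightarrow> (\<lambda>n. a n * z ^ n) sums f z"
  by (simp add: disc_series_def)

lemma disc_series_diff: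
  assumes "disc_series a f" "disc_series b g"
  shows "disc_series (\<lambda>n. a n - b n) (f - g)"
  using assms by (auto simp: disc_series_def left_diff_distrib intro: sums_diff)

lemma disc_series_cong:
  assumes "disc_series a f" "\<And>z. cmod z < 1 \<Longrightarrow> f z = g z"
  shows "disc_series a g"
  using assms by (simp add: disc_series_def)

lemma holomorphic_on_iff_disc_series: "f holomorphic_on ball 0 1 \<longleftrightarrow> (\<exists>a. disc_series a f)"
proof
  assume "f holomorphic_on ball 0 1"
  then have "disc_series (\<lambda>n. (deriv ^^ n) f 0 / fact n) f"
    using holomorphic_power_series[of f 0 1] by (auto simp: disc_series_def)
  then show "\<exists>a. disc_series a f" by blast
next
  assume "\<exists>a. disc_series a f"
  then show "f holomorphic_on ball 0 1"
    using power_series_holomorphic[of 0 1 _ f] by (auto simp: disc_series_def)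
qed

lemma summable_norm_disc_series:
  assumes "disc_series a f" "cmod z < 1"
  shows "summable (\<lambda>n. cmod (a n * z ^ n))"
proof -
  obtain r where r: "cmod z < r" "r < 1" using assms(2) dense by blast
  then have "0 \<le> r" using norm_ge_zero[of z] by linarith
  then have "cmod (of_real r) < 1" using r(2) by simp
  then have "summable (\<lambda>n. a n * of_real r ^ n)"
    using assms(1) disc_series_sums sums_summable by blast
  then show ?thesis by (rule powser_insidea) (use r in auto)
qed

lemma sum_lessThan_le_sums:
  fixes f :: "nat \<Rightarrow> real"
  assumes "f sums s" "\<And>n. 0 \<le> f n"
  shows "(\<Sum>n<N. f n) \<le> s"
  using sum_le_suminf[OF sums_summable[OF assms(1)], of "{..<N}"] assms(2)
  by (simp add: sums_unique[OF assms(1), symmetric])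

section \<open>Parseval's identity on circles\<close>

lemma has_integral_cis_of_int:
  "((\<lambda>t. cis (real_of_int k * t)) has_integral (if k = 0 then 2 * pi else 0)) {0..2*pi}"
proof (cases "k = 0")
  case True
  then show ?thesis using has_integral_const_real[of "1::complex" 0 "2*pi"] by (simp add: scaleR_conv_of_real)
next
  case False
  define F where "F t = exp (\<i> * of_int k * of_real t) / (\<i> * of_int k)" for t :: real
  have "((\<lambda>z. exp (\<i> * of_int k * z) / (\<i> * of_int k)) has_field_derivative exp (\<i> * of_int k * of_real t)) (at (of_real t))" for t
    using False by (auto intro!: derivative_eq_intros)
  then have "(F has_vector_derivative cis (real_of_int k * t)) (at t within {0..2*pi})" for t
    using has_vector_derivative_real_field has_vector_derivative_at_within
    unfolding F_def cis_conv_exp by (fastforce simp: mult_ac)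
  then have "((\<lambda>t. cis (real_of_int k * t)) has_integral (F (2*pi) - F 0)) {0..2*pi}"
    by (intro fundamental_theorem_of_calculus) auto
  moreover have "F (2*pi) = F 0"
    using exp_integer_2pi[of "of_int k"] by (simp add: F_def mult_ac)
  ultimately show ?thesis using False by simp
qed

lemma has_integral_norm_trig_poly:
  "((\<lambda>t. (cmod (\<Sum>n<N. c n * cis (real n * t)))\<^sup>2) has_integral 2 * pi * (\<Sum>n<N. (cmod (c n))\<^sup>2)) {0..2*pi}"
proof -
  have expand: "of_real ((cmod (\<Sum>n<N. c n * cis (real n * t)))\<^sup>2) =
      (\<Sum>m<N. \<Sum>n<N. c m * cnj (c n) * cis (real_of_int (int m - int n) * t))" for t
  proof -
    have "cis (real m * t) * cnj (cis (real n * t)) = cis (real_of_int (int m - int n) * t)" for m n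
      by (simp add: cis_cnj cis_mult algebra_simps)
    then show ?thesis
      by (simp only: complex_norm_square cnj_sum sum_product complex_cnj_mult) (simp add: mult_ac flip: mult.assoc)
  qed
  have orth: "((\<lambda>t. c m * cnj (c n) * cis (real_of_int (int m - int n) * t)) has_integral
      (if m = n then 2 * pi * (cmod (c m))\<^sup>2 else 0)) {0..2*pi}" for m n
  proof -
    have "c m * cnj (c n) * of_real (if int m - int n = 0 then 2 * pi else 0) =
        of_real (if m = n then 2 * pi * (cmod (c m))\<^sup>2 else 0)"
      using complex_norm_square[of "c m"] by auto
    with has_integral_mult_right[OF has_integral_cis_of_int[of "int m - int n"], of "c m * cnj (c n)"]
    show ?thesis by (simp only:)
  qed
  have "((\<lambda>t. complex_of_real ((cmod (\<Sum>n<N. c n * cis (real n * t)))\<^sup>2)) has_integral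
      (\<Sum>m<N. \<Sum>n<N. complex_of_real (if m = n then 2 * pi * (cmod (c m))\<^sup>2 else 0))) {0..2*pi}"
    unfolding expand by (intro has_integral_sum orth) auto
  from has_integral_Re[OF this] show ?thesis
    by (simp add: sum_distrib_left)
qed

lemma disc_series_parseval:
  assumes "disc_series a f" "cmod z < 1"
  shows "(\<lambda>n. (cmod (a n))\<^sup>2 * cmod z ^ (2 * n)) sums
    (integral {0..2*pi} (\<lambda>t. (cmod (f (z * cis t)))\<^sup>2) / (2 * pi))"
proof -
  define S where "S N t = (\<Sum>n<N. a n * z ^ n * cis (real n * t))" for N t
  have S: "((\<lambda>t. (cmod (S N t))\<^sup>2) has_integral 2 * pi * (\<Sum>n<N. (cmod (a n))\<^sup>2 * cmod z ^ (2 * n))) {0..2*pi}" for N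
    using has_integral_norm_trig_poly[of "\<lambda>n. a n * z ^ n" N]
    by (simp add: S_def norm_mult norm_power power_mult_distrib power_mult[symmetric] mult.commute)
  have "(\<lambda>N. integral {0..2*pi} (\<lambda>t. (cmod (S N t))\<^sup>2)) \<longlonglongrightarrow> integral {0..2*pi} (\<lambda>t. (cmod (f (z * cis t)))\<^sup>2)"
  proof (rule dominated_convergence)
    show "(\<lambda>t. (cmod (S N t))\<^sup>2) integrable_on {0..2*pi}" for N
      using S by (rule has_integral_integrable)
    show "(\<lambda>_. (\<Sum>n. cmod (a n * z ^ n))\<^sup>2) integrable_on {0..2*pi}"
      by (rule integrable_const_ivl)
    show "norm ((cmod (S N t))\<^sup>2) \<le> (\<Sum>n. cmod (a n * z ^ n))\<^sup>2" for N t
    proof -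
      have "cmod (S N t) \<le> (\<Sum>n<N. cmod (a n * z ^ n))"
        unfolding S_def by (rule order_trans[OF norm_sum]) (simp add: norm_mult)
      also have "\<dots> \<le> (\<Sum>n. cmod (a n * z ^ n))"
        using summable_norm_disc_series[OF assms] by (intro sum_le_suminf) auto
      finally show ?thesis by (simp add: power_mono)
    qed
    show "(\<lambda>N. (cmod (S N t))\<^sup>2) \<longlonglongrightarrow> (cmod (f (z * cis t)))\<^sup>2" for t
    proof -
      have "(\<lambda>n. a n * (z * cis t) ^ n) sums f (z * cis t)"
        using assms by (intro disc_series_sums) (auto simp: norm_mult)
      then have "(\<lambda>N. S N t) \<longlonglongrightarrow> f (z * cis t)"
        by (simp add: sums_def S_def power_mult_distrib Complex.DeMoivre mult_ac)
      then show ?thesis by (intro tendsto_intros)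
    qed
  qed
  then have "(\<lambda>N. 2 * pi * (\<Sum>n<N. (cmod (a n))\<^sup>2 * cmod z ^ (2 * n)) / (2 * pi)) \<longlonglongrightarrow>
      integral {0..2*pi} (\<lambda>t. (cmod (f (z * cis t)))\<^sup>2) / (2 * pi)"
    unfolding integral_unique[OF S] by (intro tendsto_divide tendsto_const) auto
  then show ?thesis by (simp add: sums_def)
qed

section \<open>The kernels \<open>(1 - cnj v z) powr -\<gamma>\<close>\<close>

definition kernel_weight :: "real \<Rightarrow> nat \<Rightarrow> real" where
  "kernel_weight \<gamma> n = pochhammer \<gamma> n / fact n"

lemma kernel_weight_pos: "0 < \<gamma> \<Longrightarrow> 0 < kernel_weight \<gamma> n"
  by (simp add: kernel_weight_def pochhammer_pos)

definition weighted_square :: "real \<Rightarrow> (nat \<Rightarrow> complex) \<Rightarrow> nat \<Rightarrow> real" where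
  "weighted_square \<gamma> a n = (cmod (a n))\<^sup>2 / kernel_weight \<gamma> n"

lemma weighted_square_one: "weighted_square 1 a = (\<lambda>n. (cmod (a n))\<^sup>2)"
  by (simp add: fun_eq_iff weighted_square_def kernel_weight_def flip: pochhammer_fact)

lemma weighted_square_nonneg: "0 < \<gamma> \<Longrightarrow> 0 \<le> weighted_square \<gamma> a n"
  by (simp add: weighted_square_def kernel_weight_pos less_imp_le)

lemma summable_weighted_square_diff:
  assumes \<gamma>: "0 < \<gamma>" and "summable (weighted_square \<gamma> a)" "summable (weighted_square \<gamma> b)"
  shows "summable (weighted_square \<gamma> (\<lambda>n. a n - b n))"
proof (rule summable_comparison_test')
  show "summable (\<lambda>n. 2 * weighted_square \<gamma> a n + 2 * weighted_square \<gamma> b n)"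
    using assms by (intro summable_add summable_mult)
  show "norm (weighted_square \<gamma> (\<lambda>n. a n - b n) n) \<le> 2 * weighted_square \<gamma> a n + 2 * weighted_square \<gamma> b n" for n
  proof -
    have "(cmod (a n - b n))\<^sup>2 \<le> (cmod (a n) + cmod (b n))\<^sup>2"
      by (intro power_mono norm_triangle_ineq4) simp
    also have "\<dots> \<le> 2 * (cmod (a n))\<^sup>2 + 2 * (cmod (b n))\<^sup>2"
      using sum_squares_bound[of "cmod (a n)" "cmod (b n)"] by (simp add: power2_sum)
    finally show ?thesis
      using kernel_weight_pos[OF \<gamma>, of n] by (simp add: weighted_square_def field_simps)
  qed
qed

lemma norm_sum_square_le_weighted:
  assumes \<gamma>: "0 < \<gamma>"
  shows "(cmod (\<Sum>n\<in>A. a n * z ^ n))\<^sup>2 \<le>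
    (\<Sum>n\<in>A. weighted_square \<gamma> a n) * (\<Sum>n\<in>A. kernel_weight \<gamma> n * ((cmod z)\<^sup>2) ^ n)"
proof -
  let ?s = "\<lambda>n. sqrt (kernel_weight \<gamma> n)"
  have s: "?s n \<noteq> 0" "(?s n)\<^sup>2 = kernel_weight \<gamma> n" for n
    using kernel_weight_pos[OF \<gamma>, of n] by simp_all
  have "cmod (\<Sum>n\<in>A. a n * z ^ n) \<le> (\<Sum>n\<in>A. (cmod (a n) / ?s n) * (?s n * cmod z ^ n))"
    using s(1) by (intro order_trans[OF norm_sum]) (simp add: norm_mult norm_power)
  then have "(cmod (\<Sum>n\<in>A. a n * z ^ n))\<^sup>2 \<le> (\<Sum>n\<in>A. (cmod (a n) / ?s n) * (?s n * cmod z ^ n))\<^sup>2"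
    by (rule power_mono) simp
  also have "\<dots> \<le> (\<Sum>n\<in>A. (cmod (a n) / ?s n)\<^sup>2) * (\<Sum>n\<in>A. (?s n * cmod z ^ n)\<^sup>2)"
    by (rule Cauchy_Schwarz_ineq_sum)
  also have "\<dots> = (\<Sum>n\<in>A. weighted_square \<gamma> a n) * (\<Sum>n\<in>A. kernel_weight \<gamma> n * ((cmod z)\<^sup>2) ^ n)"
    by (simp only: power_divide power_mult_distrib s(2) weighted_square_def power_mult[symmetric] mult.commute)
  finally show ?thesis .
qed

lemma kernel_weight_sums_complex:
  assumes "cmod z < 1"
  shows "(\<lambda>n. of_real (kernel_weight \<gamma> n) * z ^ n) sums (1 - z) powr (- of_real \<gamma>)"
proof -
  have "((- of_real \<gamma>) gchoose n) * (- z) ^ n = of_real (kernel_weight \<gamma> n) * z ^ n" for n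
    by (simp add: kernel_weight_def gbinomial_pochhammer pochhammer_of_real power_minus[of z n])
  then show ?thesis
    using gen_binomial_complex[of "- z" "- of_real \<gamma>"] assms by simp
qed

lemma kernel_weight_sums_real:
  assumes "\<bar>x\<bar> < 1"
  shows "(\<lambda>n. kernel_weight \<gamma> n * x ^ n) sums (1 - x) powr (- \<gamma>)"
proof -
  have "((- \<gamma>) gchoose n) * (- x) ^ n = kernel_weight \<gamma> n * x ^ n" for n
    by (simp add: kernel_weight_def gbinomial_pochhammer power_minus[of x n])
  then show ?thesis
    using gen_binomial_real[of "- x" "- \<gamma>"] assms by simp
qed

definition normalized_kernel :: "real \<Rightarrow> complex \<Rightarrow> complex \<Rightarrow> complex" where
  "normalized_kernel \<gamma> v z = of_real ((1 - (cmod v)\<^sup>2) powr (\<gamma> / 2)) * (1 - cnj v * z) powr (- of_real \<gamma>)"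

lemma norm_normalized_kernel:
  "cmod (normalized_kernel \<gamma> v z) = (1 - (cmod v)\<^sup>2) powr (\<gamma> / 2) * cmod (1 - cnj v * z) powr (- \<gamma>)"
  by (simp add: normalized_kernel_def norm_mult norm_powr_real_powr')

lemma one_minus_norm_square_pos: "cmod z < 1 \<Longrightarrow> 0 < 1 - (cmod z)\<^sup>2"
  by (simp add: abs_square_less_1)

lemma disc_series_normalized_kernel:
  assumes "cmod v < 1"
  shows "disc_series (\<lambda>n. of_real ((1 - (cmod v)\<^sup>2) powr (\<gamma> / 2) * kernel_weight \<gamma> n) * cnj v ^ n)
    (normalized_kernel \<gamma> v)"
  unfolding disc_series_def normalized_kernel_def
proof (intro allI impI)
  fix z assume "cmod z < 1"
  then have "cmod (cnj v * z) < 1" using norm_mult_less[of "cnj v" 1 z 1] assms by simp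
  from sums_mult[OF kernel_weight_sums_complex[OF this], of "of_real ((1 - (cmod v)\<^sup>2) powr (\<gamma> / 2))"]
  show "(\<lambda>n. of_real ((1 - (cmod v)\<^sup>2) powr (\<gamma> / 2) * kernel_weight \<gamma> n) * cnj v ^ n * z ^ n) sums
      (of_real ((1 - (cmod v)\<^sup>2) powr (\<gamma> / 2)) * (1 - cnj v * z) powr (- of_real \<gamma>))"
    by (simp add: power_mult_distrib mult_ac)
qed

lemma normalized_kernel_tendsto_zero:
  assumes \<gamma>: "0 < \<gamma>" and v: "\<And>k. cmod (v k) < 1" and lim: "(\<lambda>k. 1 - (cmod (v k))\<^sup>2) \<longlonglongrightarrow> 0"
    and z: "cmod z < 1"
  shows "(\<lambda>k. normalized_kernel \<gamma> (v k) z) \<longlonglongrightarrow> 0"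
proof (rule Lim_null_comparison)
  have "cmod (normalized_kernel \<gamma> (v k) z) \<le> (1 - (cmod (v k))\<^sup>2) powr (\<gamma> / 2) * (1 - cmod z) powr (- \<gamma>)" for k
  proof -
    have "cmod (v k) * cmod z \<le> 1 * cmod z" using v[of k] by (intro mult_right_mono) auto
    then have "1 - cmod z \<le> cmod (1 - cnj (v k) * z)"
      using norm_triangle_ineq2[of 1 "cnj (v k) * z"] by (simp add: norm_mult)
    then show ?thesis
      unfolding norm_normalized_kernel using \<gamma> z by (intro mult_left_mono powr_mono2') auto
  qed
  then show "\<forall>\<^sub>F k in sequentially. norm (normalized_kernel \<gamma> (v k) z) \<le>
      (1 - (cmod (v k))\<^sup>2) powr (\<gamma> / 2) * (1 - cmod z) powr (- \<gamma>)"
    by simp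
  have "(\<lambda>k. (1 - (cmod (v k))\<^sup>2) powr (\<gamma> / 2)) \<longlonglongrightarrow> 0"
    using \<gamma> v one_minus_norm_square_pos
    by (intro tendsto_zero_powrI[OF lim tendsto_const]) (auto intro!: always_eventually less_imp_le)
  then show "(\<lambda>k. (1 - (cmod (v k))\<^sup>2) powr (\<gamma> / 2) * (1 - cmod z) powr (- \<gamma>)) \<longlonglongrightarrow> 0"
    by (rule tendsto_mult_left_zero)
qed

section \<open>The pseudohyperbolic distance\<close>

definition pseudohyperbolic_dist :: "complex \<Rightarrow> complex \<Rightarrow> real" where
  "pseudohyperbolic_dist z w = cmod ((z - w) / (1 - cnj w * z))"

lemma norm_one_minus_cnj_mult_square:
  "(cmod (1 - cnj w * z))\<^sup>2 = (cmod (z - w))\<^sup>2 + (1 - (cmod z)\<^sup>2) * (1 - (cmod w)\<^sup>2)"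
  unfolding cmod_power2 by (simp add: power2_eq_square algebra_simps)

lemma one_minus_cnj_mult_nonzero:
  assumes "cmod w < 1" "cmod z < 1"
  shows "1 - cnj w * z \<noteq> 0"
  using norm_mult_less[of "cnj w" 1 z 1] assms by auto

lemma one_minus_norm_square_mult_le:
  assumes z: "cmod z < 1" and w: "cmod w < 1" and \<delta>: "0 \<le> \<delta>" "\<delta> \<le> pseudohyperbolic_dist z w"
  shows "(1 - (cmod z)\<^sup>2) * (1 - (cmod w)\<^sup>2) \<le> (1 - \<delta>\<^sup>2) * (cmod (1 - cnj w * z))\<^sup>2"
proof -
  have "\<delta>\<^sup>2 \<le> (pseudohyperbolic_dist z w)\<^sup>2" using \<delta> by (intro power_mono)
  then have "\<delta>\<^sup>2 * (cmod (1 - cnj w * z))\<^sup>2 \<le> (cmod (z - w))\<^sup>2"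
    using one_minus_cnj_mult_nonzero[OF w z]
    by (simp add: pseudohyperbolic_dist_def norm_divide power_divide pos_le_divide_eq)
  then show ?thesis
    unfolding left_diff_distrib norm_one_minus_cnj_mult_square by simp
qed

lemma pseudohyperbolic_dist_less_one:
  assumes "cmod z < 1" "cmod w < 1"
  shows "pseudohyperbolic_dist z w < 1"
proof -
  have "0 < (1 - (cmod z)\<^sup>2) * (1 - (cmod w)\<^sup>2)"
    using assms by (intro mult_pos_pos one_minus_norm_square_pos)
  then have "(cmod (z - w))\<^sup>2 < (cmod (1 - cnj w * z))\<^sup>2"
    unfolding norm_one_minus_cnj_mult_square by simp
  then have "cmod (z - w) < cmod (1 - cnj w * z)" by (rule power2_less_imp_less) simp
  then show ?thesis
    using one_minus_cnj_mult_nonzero[OF assms(2,1)] by (simp add: pseudohyperbolic_dist_def norm_divide)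
qed

section \<open>Separation of points by kernels\<close>

lemma normalized_kernel_diff_ge:
  assumes \<gamma>: "0 < \<gamma>" and v: "cmod v < 1" and z: "cmod z < 1"
    and q: "1 - (cmod v)\<^sup>2 \<le> q * cmod (1 - cnj v * z)"
  shows "1 - q powr \<gamma> \<le> cmod (normalized_kernel \<gamma> v v - normalized_kernel \<gamma> v z) * (1 - (cmod v)\<^sup>2) powr (\<gamma> / 2)"
proof -
  define D where "D = 1 - (cmod v)\<^sup>2"
  define E where "E = cmod (1 - cnj v * z)"
  have D: "0 < D" unfolding D_def by (rule one_minus_norm_square_pos[OF v])
  have E: "0 < E" using one_minus_cnj_mult_nonzero[OF v z] by (simp add: E_def)
  have "1 - cnj v * v = of_real D" using complex_norm_square[of v] by (simp add: D_def mult.commute)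
  then have diag: "cmod (normalized_kernel \<gamma> v v) * D powr (\<gamma> / 2) = 1"
    using D by (simp add: norm_normalized_kernel flip: D_def powr_add)
  have off_diag: "cmod (normalized_kernel \<gamma> v z) = D powr (\<gamma> / 2) * E powr (- \<gamma>)"
    by (simp add: norm_normalized_kernel D_def E_def)
  have "D powr (\<gamma> / 2) * E powr (- \<gamma>) * D powr (\<gamma> / 2) = (D / E) powr \<gamma>"
    using D E by (simp add: powr_divide powr_minus_divide mult.assoc flip: powr_add)
  also have "\<dots> \<le> q powr \<gamma>"
    using q \<gamma> D E by (intro powr_mono2) (simp_all add: D_def E_def pos_divide_le_eq)
  finally have "1 - q powr \<gamma> \<le> 1 - D powr (\<gamma> / 2) * E powr (- \<gamma>) * D powr (\<gamma> / 2)" by simp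
  also have "\<dots> = (cmod (normalized_kernel \<gamma> v v) - cmod (normalized_kernel \<gamma> v z)) * D powr (\<gamma> / 2)"
    by (simp add: left_diff_distrib diag off_diag)
  also have "\<dots> \<le> cmod (normalized_kernel \<gamma> v v - normalized_kernel \<gamma> v z) * D powr (\<gamma> / 2)"
    by (intro mult_right_mono norm_triangle_ineq2) simp
  finally show ?thesis by (simp add: D_def)
qed

text \<open>For the pseudohyperbolic distance \<open>\<rho>\<close>, \<open>1 - \<rho>(x, y)\<^sup>2\<close> is the product of \<open>(1 - \<bar>x\<bar>\<^sup>2) / \<bar>1 - cnj x y\<bar>\<close> and
  the same quotient with \<open>x\<close> and \<open>y\<close> exchanged, so one of the two is at most \<open>sqrt (1 - \<rho>(x, y)\<^sup>2)\<close>.\<close>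

lemma normalized_kernel_separates:
  assumes \<gamma>: "0 < \<gamma>" and x: "cmod x < 1" and y: "cmod y < 1"
    and \<delta>: "0 \<le> \<delta>" "\<delta> \<le> pseudohyperbolic_dist x y"
  shows "\<exists>v\<in>{x, y}. 1 - sqrt (1 - \<delta>\<^sup>2) powr \<gamma> \<le>
    cmod (normalized_kernel \<gamma> v x - normalized_kernel \<gamma> v y) * (1 - (cmod v)\<^sup>2) powr (\<gamma> / 2)"
proof -
  define q where "q = sqrt (1 - \<delta>\<^sup>2)"
  have min_le: "min X Y \<le> q * E"
    if "X * Y \<le> (1 - \<delta>\<^sup>2) * E\<^sup>2" "0 < X" "0 < Y" "0 \<le> E" for X Y E :: real
  proof -
    have "(min X Y)\<^sup>2 \<le> X * Y" using that by (auto simp: min_def power2_eq_square mult_left_mono mult_right_mono)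
    also note that(1)
    finally have "min X Y \<le> sqrt ((1 - \<delta>\<^sup>2) * E\<^sup>2)" by (rule real_le_rsqrt)
    then show ?thesis using that(4) by (simp add: q_def real_sqrt_mult)
  qed
  have sym: "cmod (1 - cnj x * y) = cmod (1 - cnj y * x)"
    by (metis complex_cnj_cnj complex_cnj_diff complex_cnj_mult complex_cnj_one complex_mod_cnj mult.commute)
  have "min (1 - (cmod x)\<^sup>2) (1 - (cmod y)\<^sup>2) \<le> q * cmod (1 - cnj y * x)"
    using one_minus_norm_square_mult_le[OF x y \<delta>] x y by (intro min_le one_minus_norm_square_pos) auto
  then consider (at_x) "1 - (cmod x)\<^sup>2 \<le> q * cmod (1 - cnj x * y)" | (at_y) "1 - (cmod y)\<^sup>2 \<le> q * cmod (1 - cnj y * x)"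
    unfolding sym min_le_iff_disj by blast
  then show ?thesis
  proof cases
    case at_x
    from normalized_kernel_diff_ge[OF \<gamma> x y this] show ?thesis by (simp add: q_def)
  next
    case at_y
    from normalized_kernel_diff_ge[OF \<gamma> y x this] show ?thesis by (simp add: q_def norm_minus_commute)
  qed
qed

section \<open>Weighted Hardy spaces\<close>

locale weighted_hardy_space =
  fixes \<gamma> :: real and mem :: "(complex \<Rightarrow> complex) \<Rightarrow> bool" and nrm :: "(complex \<Rightarrow> complex) \<Rightarrow> real"
  assumes \<gamma>_pos: "0 < \<gamma>"
    and mem_iff: "mem f \<longleftrightarrow> (\<exists>a. disc_series a f \<and> summable (weighted_square \<gamma> a))"
    and nrm_eq: "disc_series a f \<Longrightarrow> weighted_square \<gamma> a sums S \<Longrightarrow> nrm f = sqrt S"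
begin

lemma mem_disc_seriesE:
  assumes "mem f"
  obtains a where "disc_series a f" "weighted_square \<gamma> a sums (nrm f)\<^sup>2"
proof -
  obtain a where a: "disc_series a f" and sm: "summable (weighted_square \<gamma> a)"
    using assms mem_iff by blast
  have "0 \<le> (\<Sum>n. weighted_square \<gamma> a n)"
    by (intro suminf_nonneg sm weighted_square_nonneg \<gamma>_pos)
  with nrm_eq[OF a summable_sums[OF sm]] show ?thesis
    using that[OF a] summable_sums[OF sm] by simp
qed

lemma mem_diff:
  assumes "mem f" "mem g"
  shows "mem (f - g)"
proof -
  obtain a b where "disc_series a f" "disc_series b g"
    and "summable (weighted_square \<gamma> a)" "summable (weighted_square \<gamma> b)"
    using assms mem_iff by meson
  then show ?thesis
    using disc_series_diff summable_weighted_square_diff[OF \<gamma>_pos] mem_iff by blast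
qed

lemma nrm_cong_disc:
  assumes "mem f" "\<And>z. cmod z < 1 \<Longrightarrow> f z = g z"
  shows "nrm f = nrm g"
  using assms by (metis disc_series_cong mem_disc_seriesE nrm_eq)

lemma point_evaluation_le:
  assumes "mem f" "cmod w < 1"
  shows "(cmod (f w))\<^sup>2 * (1 - (cmod w)\<^sup>2) powr \<gamma> \<le> (nrm f)\<^sup>2"
proof -
  obtain a where a: "disc_series a f" and norm_a: "weighted_square \<gamma> a sums (nrm f)\<^sup>2"
    using assms(1) by (rule mem_disc_seriesE)
  have D: "0 < 1 - (cmod w)\<^sup>2" using assms(2) by (rule one_minus_norm_square_pos)
  have kernel: "(\<lambda>n. kernel_weight \<gamma> n * ((cmod w)\<^sup>2) ^ n) sums (1 - (cmod w)\<^sup>2) powr (- \<gamma>)"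
    using D by (intro kernel_weight_sums_real) auto
  have "(cmod (\<Sum>n<N. a n * w ^ n))\<^sup>2 \<le> (nrm f)\<^sup>2 * (1 - (cmod w)\<^sup>2) powr (- \<gamma>)" for N
  proof -
    have "(\<Sum>n<N. weighted_square \<gamma> a n) \<le> (nrm f)\<^sup>2"
      by (intro sum_lessThan_le_sums[OF norm_a] weighted_square_nonneg \<gamma>_pos)
    moreover have "(\<Sum>n<N. kernel_weight \<gamma> n * ((cmod w)\<^sup>2) ^ n) \<le> (1 - (cmod w)\<^sup>2) powr (- \<gamma>)"
      using kernel_weight_pos[OF \<gamma>_pos] by (intro sum_lessThan_le_sums[OF kernel]) (simp add: less_imp_le)
    ultimately have "(\<Sum>n<N. weighted_square \<gamma> a n) * (\<Sum>n<N. kernel_weight \<gamma> n * ((cmod w)\<^sup>2) ^ n) \<le>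
        (nrm f)\<^sup>2 * (1 - (cmod w)\<^sup>2) powr (- \<gamma>)"
      using kernel_weight_pos[OF \<gamma>_pos] by (intro mult_mono sum_nonneg) (simp_all add: less_imp_le)
    with norm_sum_square_le_weighted[OF \<gamma>_pos] show ?thesis by (rule order_trans)
  qed
  moreover have "(\<lambda>N. (cmod (\<Sum>n<N. a n * w ^ n))\<^sup>2) \<longlonglongrightarrow> (cmod (f w))\<^sup>2"
    using disc_series_sums[OF a assms(2)] unfolding sums_def by (intro tendsto_intros)
  ultimately have "(cmod (f w))\<^sup>2 \<le> (nrm f)\<^sup>2 * (1 - (cmod w)\<^sup>2) powr (- \<gamma>)"
    by (intro LIMSEQ_le_const2) auto
  then show ?thesis using D by (simp add: powr_minus_divide pos_le_divide_eq)
qed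

lemma normalized_kernel_mem_nrm:
  assumes "cmod v < 1"
  shows "mem (normalized_kernel \<gamma> v)" "nrm (normalized_kernel \<gamma> v) = 1"
proof -
  define D where "D = 1 - (cmod v)\<^sup>2"
  have D: "0 < D" unfolding D_def using assms by (rule one_minus_norm_square_pos)
  let ?a = "\<lambda>n. of_real (D powr (\<gamma> / 2) * kernel_weight \<gamma> n) * cnj v ^ n"
  have "weighted_square \<gamma> ?a n = D powr \<gamma> * (kernel_weight \<gamma> n * ((cmod v)\<^sup>2) ^ n)" for n
    using kernel_weight_pos[OF \<gamma>_pos, of n] D
    by (simp add: weighted_square_def norm_mult norm_power power_mult_distrib powr_power power2_eq_square mult_ac
        flip: power_mult powr_add)
  then have square: "weighted_square \<gamma> ?a = (\<lambda>n. D powr \<gamma> * (kernel_weight \<gamma> n * ((cmod v)\<^sup>2) ^ n))"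
    by (rule ext)
  have "(\<lambda>n. kernel_weight \<gamma> n * ((cmod v)\<^sup>2) ^ n) sums D powr (- \<gamma>)"
    using D unfolding D_def by (intro kernel_weight_sums_real) auto
  then have "weighted_square \<gamma> ?a sums (D powr \<gamma> * D powr (- \<gamma>))"
    unfolding square by (rule sums_mult)
  then have norm_a: "weighted_square \<gamma> ?a sums 1"
    using D by (simp del: of_real_mult flip: powr_add)
  note a = disc_series_normalized_kernel[OF assms, of \<gamma>, folded D_def]
  show "mem (normalized_kernel \<gamma> v)" using a sums_summable[OF norm_a] mem_iff by blast
  show "nrm (normalized_kernel \<gamma> v) = 1" using nrm_eq[OF a norm_a] by simp
qed

lemma compact_op_on_pointwise_null:
  assumes T: "compact_op_on mem nrm T" and f: "\<And>k. mem (f k)" "\<And>k. nrm (f k) \<le> 1"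
    and null: "\<And>z. cmod z < 1 \<Longrightarrow> (\<lambda>k. T (f k) z) \<longlonglongrightarrow> 0"
  obtains r where "strict_mono r" "(\<lambda>k. nrm (T (f (r k)))) \<longlonglongrightarrow> 0"
proof -
  obtain r g where r: "strict_mono r" and g: "mem g" and conv: "(\<lambda>k. nrm (T (f (r k)) - g)) \<longlonglongrightarrow> 0"
    using T f unfolding compact_op_on_def by blast
  have diff: "mem (T (f k) - g)" for k
    using T f g by (auto simp: compact_op_on_def intro: mem_diff)
  have "g z = 0" if z: "cmod z < 1" for z
  proof -
    define D where "D = (1 - (cmod z)\<^sup>2) powr \<gamma>"
    have D: "0 < D" using one_minus_norm_square_pos[OF z] by (simp add: D_def)
    have "(\<lambda>k. (cmod ((T (f (r k)) - g) z))\<^sup>2) \<longlonglongrightarrow> 0"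
    proof (rule Lim_null_comparison)
      show "\<forall>\<^sub>F k in sequentially. norm ((cmod ((T (f (r k)) - g) z))\<^sup>2) \<le> (nrm (T (f (r k)) - g))\<^sup>2 / D"
        using point_evaluation_le[OF diff z] D by (simp add: D_def pos_le_divide_eq)
      show "(\<lambda>k. (nrm (T (f (r k)) - g))\<^sup>2 / D) \<longlonglongrightarrow> 0"
        using tendsto_divide[OF tendsto_power[OF conv, of 2] tendsto_const[of D]] D by simp
    qed
    then have "(\<lambda>k. T (f (r k)) z - g z) \<longlonglongrightarrow> 0"
      using tendsto_real_sqrt[of "\<lambda>k. (cmod (T (f (r k)) z - g z))\<^sup>2" 0] by (simp add: tendsto_norm_zero_iff)
    moreover have "(\<lambda>k. T (f (r k)) z - g z) \<longlonglongrightarrow> 0 - g z"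
      using LIMSEQ_subseq_LIMSEQ[OF null[OF z] r] by (intro tendsto_intros) (simp add: o_def)
    ultimately show ?thesis using LIMSEQ_unique by fastforce
  qed
  then have "nrm (T (f (r k)) - g) = nrm (T (f (r k)))" for k
    by (intro nrm_cong_disc diff) simp
  with conv that[OF r] show ?thesis by simp
qed

lemma nrm_comp_op_diff_normalized_kernel_ge:
  assumes x: "cmod (\<phi> w) < 1" and y: "cmod (\<psi> w) < 1" and w: "cmod w < 1"
    and mem: "\<And>v. cmod v < 1 \<Longrightarrow> mem (comp_op \<phi> (normalized_kernel \<gamma> v) - comp_op \<psi> (normalized_kernel \<gamma> v))"
    and C: "1 - (cmod (\<phi> w))\<^sup>2 \<le> C * (1 - (cmod w)\<^sup>2)" "1 - (cmod (\<psi> w))\<^sup>2 \<le> C * (1 - (cmod w)\<^sup>2)"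
    and \<delta>: "0 < \<delta>" "\<delta> \<le> pseudohyperbolic_dist (\<phi> w) (\<psi> w)"
  shows "\<exists>v\<in>{\<phi> w, \<psi> w}. (1 - sqrt (1 - \<delta>\<^sup>2) powr \<gamma>)\<^sup>2 \<le>
    C powr \<gamma> * (nrm (comp_op \<phi> (normalized_kernel \<gamma> v) - comp_op \<psi> (normalized_kernel \<gamma> v)))\<^sup>2"
proof -
  define m where "m = 1 - sqrt (1 - \<delta>\<^sup>2) powr \<gamma>"
  have "\<delta> < 1" using \<delta>(2) pseudohyperbolic_dist_less_one[OF x y] by (rule le_less_trans)
  then have "sqrt (1 - \<delta>\<^sup>2) powr \<gamma> \<le> 1 powr \<gamma>"
    using \<delta>(1) \<gamma>_pos by (intro powr_mono2) (auto simp: abs_square_le_1)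
  then have m: "0 \<le> m" by (simp add: m_def)
  obtain v where v: "v \<in> {\<phi> w, \<psi> w}"
    and m_le: "m \<le> cmod (normalized_kernel \<gamma> v (\<phi> w) - normalized_kernel \<gamma> v (\<psi> w)) * (1 - (cmod v)\<^sup>2) powr (\<gamma> / 2)"
    using normalized_kernel_separates[OF \<gamma>_pos x y _ \<delta>(2)] \<delta>(1) unfolding m_def by auto
  define h where "h = comp_op \<phi> (normalized_kernel \<gamma> v) - comp_op \<psi> (normalized_kernel \<gamma> v)"
  have v_disc: "cmod v < 1" and v_bound: "1 - (cmod v)\<^sup>2 \<le> C * (1 - (cmod w)\<^sup>2)" using v x y C by auto
  have D: "0 < 1 - (cmod v)\<^sup>2" "0 < 1 - (cmod w)\<^sup>2"
    by (intro one_minus_norm_square_pos v_disc w)+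
  have "0 < C" using less_le_trans[OF D(1) v_bound] D(2) by (rule zero_less_mult_pos2)
  have "m\<^sup>2 \<le> (cmod (h w) * (1 - (cmod v)\<^sup>2) powr (\<gamma> / 2))\<^sup>2"
    using m_le m by (intro power_mono) (auto simp: h_def comp_op_def)
  also have "\<dots> = (cmod (h w))\<^sup>2 * (1 - (cmod v)\<^sup>2) powr \<gamma>"
    using D by (simp add: power_mult_distrib powr_power)
  also have "\<dots> \<le> (cmod (h w))\<^sup>2 * (C * (1 - (cmod w)\<^sup>2)) powr \<gamma>"
    using D v_bound \<gamma>_pos by (intro mult_left_mono powr_mono2) auto
  also have "\<dots> = C powr \<gamma> * ((cmod (h w))\<^sup>2 * (1 - (cmod w)\<^sup>2) powr \<gamma>)"
    using D \<open>0 < C\<close> by (simp add: powr_mult)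
  also have "\<dots> \<le> C powr \<gamma> * (nrm h)\<^sup>2"
    unfolding h_def by (intro mult_left_mono point_evaluation_le mem v_disc w) simp
  finally show ?thesis using v unfolding m_def h_def by blast
qed

theorem not_compact_comp_op_diff:
  assumes self: "\<And>z. cmod z < 1 \<Longrightarrow> cmod (\<phi> z) < 1" "\<And>z. cmod z < 1 \<Longrightarrow> cmod (\<psi> z) < 1"
    and w: "\<And>k. cmod (w k) < 1" "(\<lambda>k. 1 - (cmod (w k))\<^sup>2) \<longlonglongrightarrow> 0"
    and C: "\<And>k. 1 - (cmod (\<phi> (w k)))\<^sup>2 \<le> C * (1 - (cmod (w k))\<^sup>2)"
      "\<And>k. 1 - (cmod (\<psi> (w k)))\<^sup>2 \<le> C * (1 - (cmod (w k))\<^sup>2)"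
    and \<delta>: "0 < \<delta>" "\<And>k. \<delta> \<le> pseudohyperbolic_dist (\<phi> (w k)) (\<psi> (w k))"
  shows "\<not> compact_op_on mem nrm (\<lambda>f. comp_op \<phi> f - comp_op \<psi> f)"
proof
  define T where "T = (\<lambda>f. comp_op \<phi> f - comp_op \<psi> f)"
  define m where "m = 1 - sqrt (1 - \<delta>\<^sup>2) powr \<gamma>"
  assume "compact_op_on mem nrm (\<lambda>f. comp_op \<phi> f - comp_op \<psi> f)"
  then have T: "compact_op_on mem nrm T" by (simp add: T_def)
  then have mem_T: "mem (T (normalized_kernel \<gamma> v))" if "cmod v < 1" for v
    using normalized_kernel_mem_nrm(1)[OF that] by (simp add: compact_op_on_def)
  have "\<exists>v\<in>{\<phi> (w k), \<psi> (w k)}. m\<^sup>2 \<le> C powr \<gamma> * (nrm (T (normalized_kernel \<gamma> v)))\<^sup>2" for k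
    unfolding m_def T_def
    by (rule nrm_comp_op_diff_normalized_kernel_ge[OF self[OF w(1)] w(1) mem_T[unfolded T_def] C \<delta>])
  then obtain v where v: "\<And>k. v k \<in> {\<phi> (w k), \<psi> (w k)}"
    and lower: "\<And>k. m\<^sup>2 \<le> C powr \<gamma> * (nrm (T (normalized_kernel \<gamma> (v k))))\<^sup>2"
    by metis
  have v_disc: "cmod (v k) < 1" and v_bound: "1 - (cmod (v k))\<^sup>2 \<le> C * (1 - (cmod (w k))\<^sup>2)" for k
    using v[of k] self[OF w(1)] C[of k] by auto
  have "(\<lambda>k. 1 - (cmod (v k))\<^sup>2) \<longlonglongrightarrow> 0"
    using v_bound one_minus_norm_square_pos[OF v_disc, THEN less_imp_le]
    by (intro real_tendsto_sandwich[OF _ _ tendsto_const tendsto_mult_right_zero[OF w(2), of C]])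
       simp_all
  note kernel_null = normalized_kernel_tendsto_zero[OF \<gamma>_pos v_disc this]
  have "(\<lambda>k. T (normalized_kernel \<gamma> (v k)) z) \<longlonglongrightarrow> 0" if "cmod z < 1" for z
    using tendsto_diff[OF kernel_null[OF self(1)[OF that]] kernel_null[OF self(2)[OF that]]]
    by (simp add: T_def comp_op_def)
  then obtain r where "strict_mono r" and "(\<lambda>k. nrm (T (normalized_kernel \<gamma> (v (r k))))) \<longlonglongrightarrow> 0"
    using compact_op_on_pointwise_null[OF T, of "\<lambda>k. normalized_kernel \<gamma> (v k)"] normalized_kernel_mem_nrm v_disc by auto
  from this(2) have "(\<lambda>k. C powr \<gamma> * (nrm (T (normalized_kernel \<gamma> (v (r k)))))\<^sup>2) \<longlonglongrightarrow> C powr \<gamma> * 0\<^sup>2"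
    by (intro tendsto_intros)
  then have "m\<^sup>2 \<le> C powr \<gamma> * 0\<^sup>2"
    using lower by (intro LIMSEQ_le_const) auto
  moreover have "sqrt (1 - \<delta>\<^sup>2) powr \<gamma> < 1 powr \<gamma>"
    using \<delta>(1) le_less_trans[OF \<delta>(2) pseudohyperbolic_dist_less_one[OF self[OF w(1)]]] \<gamma>_pos
    by (intro powr_less_mono2) (auto simp: abs_square_le_1)
  ultimately show False by (simp add: m_def)
qed

end

section \<open>The Hardy space\<close>

lemma powser_nonneg_tendsto_at_left_one:
  fixes c :: "nat \<Rightarrow> real" and k :: "nat \<Rightarrow> nat"
  assumes nonneg: "\<And>n. 0 \<le> c n" and F: "\<And>r. 0 < r \<Longrightarrow> r < 1 \<Longrightarrow> (\<lambda>n. c n * r ^ k n) sums F r"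
    and L: "c sums L"
  shows "(F \<longlongrightarrow> L) (at_left 1)"
proof (rule increasing_tendsto)
  have near_one: "\<forall>\<^sub>F r in at_left (1::real). 0 < r \<and> r < 1"
    using eventually_at_left_real[OF zero_less_one] by simp
  then show "\<forall>\<^sub>F r in at_left 1. F r \<le> L"
  proof eventually_elim
    case (elim r)
    then have "c n * r ^ k n \<le> c n" for n
      using nonneg by (simp add: mult_left_le power_le_one)
    moreover have "(\<lambda>n. c n * r ^ k n) sums F r" using F elim by simp
    ultimately show ?case using L by (rule sums_le)
  qed
  fix x assume "x < L"
  then obtain N where "x < (\<Sum>n<N. c n)"
    using L order_tendstoD(1)[of "\<lambda>N. \<Sum>n<N. c n" L sequentially x] eventually_happens'
    unfolding sums_def by (metis sequentially_bot)
  moreover have "((\<lambda>r. \<Sum>n<N. c n * r ^ k n) \<longlongrightarrow> (\<Sum>n<N. c n * 1 ^ k n)) (at_left 1)"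
    by (intro tendsto_intros)
  ultimately have "\<forall>\<^sub>F r in at_left 1. x < (\<Sum>n<N. c n * r ^ k n)"
    using order_tendstoD(1) by fastforce
  with near_one show "\<forall>\<^sub>F r in at_left 1. x < F r"
  proof eventually_elim
    case (elim r)
    then have F_r: "(\<lambda>n. c n * r ^ k n) sums F r" using F by simp
    have "(\<Sum>n<N. c n * r ^ k n) \<le> F r"
      using elim nonneg by (intro sum_lessThan_le_sums[OF F_r]) auto
    then show ?case using elim by simp
  qed
qed

lemma powser_nonneg_tendsto_at_left_one_iff:
  fixes c :: "nat \<Rightarrow> real" and k :: "nat \<Rightarrow> nat"
  assumes nonneg: "\<And>n. 0 \<le> c n" and F: "\<And>r. 0 < r \<Longrightarrow> r < 1 \<Longrightarrow> (\<lambda>n. c n * r ^ k n) sums F r"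
  shows "(F \<longlongrightarrow> L) (at_left 1) \<longleftrightarrow> c sums L"
proof
  assume L: "(F \<longlongrightarrow> L) (at_left 1)"
  have "(\<Sum>n<N. c n) \<le> L" for N
  proof -
    have partial: "((\<lambda>r. \<Sum>n<N. c n * r ^ k n) \<longlongrightarrow> (\<Sum>n<N. c n * 1 ^ k n)) (at_left 1)"
      by (intro tendsto_intros)
    have "\<forall>\<^sub>F r in at_left 1. (\<Sum>n<N. c n * r ^ k n) \<le> F r"
      using eventually_at_left_real[OF zero_less_one]
    proof eventually_elim
      case (elim r)
      then have F_r: "(\<lambda>n. c n * r ^ k n) sums F r" using F by simp
      show ?case using elim nonneg by (intro sum_lessThan_le_sums[OF F_r]) auto
    qed
    from tendsto_le[OF _ L partial this] show ?thesis by simp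
  qed
  then have "summable c" using nonneg by (intro summableI_nonneg_bounded)
  then have sums: "c sums suminf c" by (rule summable_sums)
  with nonneg F have "(F \<longlongrightarrow> suminf c) (at_left 1)"
    by (rule powser_nonneg_tendsto_at_left_one)
  then have "L = suminf c" using L by (intro tendsto_unique) auto
  with sums show "c sums L" by simp
next
  assume "c sums L"
  with nonneg F show "(F \<longlongrightarrow> L) (at_left 1)"
    by (rule powser_nonneg_tendsto_at_left_one)
qed

lemma hardy_mean_sums:
  assumes "disc_series a f" "0 \<le> r" "r < 1"
  shows "(\<lambda>n. (cmod (a n))\<^sup>2 * r ^ (2 * n)) sums hardy_mean f r"
  using disc_series_parseval[OF assms(1), of "of_real r"] assms(2,3) by (simp add: hardy_mean_def)

lemma weighted_hardy_space_H2: "weighted_hardy_space 1 in_H2 H2_norm"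
proof
  have mean_tendsto_iff: "(hardy_mean f \<longlongrightarrow> L) (at_left 1) \<longleftrightarrow> (\<lambda>n. (cmod (a n))\<^sup>2) sums L"
    if "disc_series a f" for a f L
    using that by (intro powser_nonneg_tendsto_at_left_one_iff[where k = "\<lambda>n. 2 * n"] hardy_mean_sums) auto
  show "in_H2 f \<longleftrightarrow> (\<exists>a. disc_series a f \<and> summable (weighted_square 1 a))" for f
  proof -
    have "in_H2 f \<longleftrightarrow> (\<exists>a L. disc_series a f \<and> (hardy_mean f \<longlongrightarrow> L) (at_left 1))"
      unfolding in_H2_def holomorphic_on_iff_disc_series by blast
    also have "\<dots> \<longleftrightarrow> (\<exists>a L. disc_series a f \<and> (\<lambda>n. (cmod (a n))\<^sup>2) sums L)"
      using mean_tendsto_iff by blast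
    finally show ?thesis by (simp add: summable_def weighted_square_one)
  qed
  show "H2_norm f = sqrt S"
    if "disc_series a f" "weighted_square 1 a sums S" for a f S
    using that mean_tendsto_iff[of a f S] tendsto_Lim[of "at_left 1" "hardy_mean f" S]
    by (simp add: H2_norm_def weighted_square_one)
qed simp

section \<open>Polar integration\<close>

text \<open>Vitali's theorem fills an open set, up to a null set, with disjoint balls; an orthogonal transformation maps
  them to disjoint balls of the same radii.\<close>

lemma open_Vitali_balls:
  fixes U :: "'a::euclidean_space set"
  assumes "open U"
  obtains C :: "('a \<times> real) set" where "countable C" "\<And>i. i \<in> C \<Longrightarrow> 0 < snd i \<and> ball (fst i) (snd i) \<subseteq> U"
    "disjoint_family_on (\<lambda>i. ball (fst i) (snd i)) C" "negligible (U - (\<Union>i\<in>C. ball (fst i) (snd i)))"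
proof -
  let ?K = "{i. 0 < snd i \<and> ball (fst i) (snd i) \<subseteq> U}"
  have fine: "\<exists>i. i \<in> ?K \<and> x \<in> ball (fst i) (snd i) \<and> snd i < d" if "x \<in> U" "0 < d" for x d
  proof -
    obtain e where "0 < e" "ball x e \<subseteq> U" using assms \<open>x \<in> U\<close> openE by blast
    then show ?thesis using \<open>0 < d\<close> by (intro exI[of _ "(x, min e (d / 2))"]) auto
  qed
  obtain C where "countable C" "C \<subseteq> ?K" "pairwise (\<lambda>i j. disjnt (ball (fst i) (snd i)) (ball (fst j) (snd j))) C"
    "negligible (U - (\<Union>i\<in>C. ball (fst i) (snd i)))"
    using Vitali_covering_theorem_balls[OF fine] .
  then show ?thesis
    by (intro that) (auto simp: disjoint_family_on_def pairwise_def disjnt_def)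
qed

lemma emeasure_orthogonal_image_Vitali:
  fixes h :: "'a::euclidean_space \<Rightarrow> 'a"
  assumes h: "orthogonal_transformation h" and U: "open U"
    and C: "countable C" "\<And>i. i \<in> C \<Longrightarrow> 0 < snd i \<and> ball (fst i) (snd i) \<subseteq> U"
      "disjoint_family_on (\<lambda>i. ball (fst i) (snd i)) C"
    and null: "negligible (U - (\<Union>i\<in>C. ball (fst i) (snd i)))"
  shows "emeasure lborel (h ` U) = (\<integral>\<^sup>+i. emeasure lborel (ball (fst i) (snd i)) \<partial>count_space C)"
proof -
  let ?B = "\<lambda>i. ball (fst i) (snd i)" and ?hB = "\<lambda>i. ball (h (fst i)) (snd i)"
  note linear_h = orthogonal_transformation_linear[OF h] and inj_h = orthogonal_transformation_inj[OF h]
  have image_ball: "h ` ?B i = ?hB i" for i by (rule image_orthogonal_transformation_ball[OF h])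
  have null_h: "h ` U - (\<Union>i\<in>C. ?hB i) \<in> null_sets lborel"
  proof -
    have "negligible (h ` (U - (\<Union>i\<in>C. ?B i)))"
      using null linear_h
      by (intro negligible_differentiable_image_negligible linear_imp_differentiable_on) auto
    then have "negligible (h ` U - (\<Union>i\<in>C. ?hB i))"
      by (simp add: image_set_diff[OF inj_h] image_UN image_ball)
    moreover have "h ` U - (\<Union>i\<in>C. ?hB i) \<in> sets borel"
      using open_surjective_linear_image[OF U linear_h orthogonal_transformation_surj[OF h]]
      by (intro sets.Diff borel_open open_UN ballI open_ball)
    ultimately show ?thesis by (simp add: negligible_iff_null_sets null_sets_completion_iff)
  qed
  have "?hB i \<subseteq> h ` U" if "i \<in> C" for i using C(2)[OF that] by (auto simp flip: image_ball)
  then have "emeasure lborel (h ` U) = emeasure lborel ((\<Union>i\<in>C. ?hB i) \<union> (h ` U - (\<Union>i\<in>C. ?hB i)))"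
    by (intro arg_cong[where f = "emeasure lborel"]) blast
  also have "\<dots> = emeasure lborel (\<Union>i\<in>C. ?hB i)"
    by (rule emeasure_Un_null_set[OF _ null_h]) (auto intro!: borel_open)
  also have "\<dots> = (\<integral>\<^sup>+i. emeasure lborel (?hB i) \<partial>count_space C)"
  proof (rule emeasure_UN_countable)
    show "disjoint_family_on ?hB C"
      using C(3) by (simp add: disjoint_family_on_def image_Int[OF inj_h, symmetric] flip: image_ball)
  qed (use C(1) in simp_all)
  also have "\<dots> = (\<integral>\<^sup>+i. emeasure lborel (?B i) \<partial>count_space C)"
    using C(2) by (intro nn_integral_cong) (simp add: emeasure_ball less_imp_le)
  finally show ?thesis .
qed

lemma emeasure_orthogonal_vimage_open:
  fixes f :: "'a::euclidean_space \<Rightarrow> 'a"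
  assumes f: "orthogonal_transformation f" and U: "open U"
  shows "emeasure lborel (f -` U) = emeasure lborel U"
proof -
  obtain C where C: "countable C" "\<And>i. i \<in> C \<Longrightarrow> 0 < snd i \<and> ball (fst i) (snd i) \<subseteq> U"
    "disjoint_family_on (\<lambda>i. ball (fst i) (snd i)) C" "negligible (U - (\<Union>i\<in>C. ball (fst i) (snd i)))"
    using open_Vitali_balls[OF U] by blast
  have "f -` U = inv f ` U"
    by (rule bij_vimage_eq_inv_image[OF orthogonal_transformation_bij[OF f]])
  then show ?thesis
    using emeasure_orthogonal_image_Vitali[OF orthogonal_transformation_inv[OF f] U C]
      emeasure_orthogonal_image_Vitali[OF orthogonal_transformation_id U C] by simp
qed

lemma distr_lborel_orthogonal_transformation:
  fixes f :: "'a::euclidean_space \<Rightarrow> 'a"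
  assumes f: "orthogonal_transformation f"
  shows "distr lborel borel f = lborel"
proof (rule measure_eqI_generator_eq)
  have [measurable]: "f \<in> borel_measurable borel"
    using f by (intro borel_measurable_continuous_onI linear_continuous_on)
      (simp add: linear_conv_bounded_linear[symmetric] orthogonal_transformation_linear)
  show "Int_stable (Collect open :: 'a set set)" by (auto simp: Int_stable_def)
  show "emeasure (distr lborel borel f) U = emeasure lborel U" if "U \<in> Collect open" for U
    using that emeasure_orthogonal_vimage_open[OF f] by (simp add: emeasure_distr)
  show "range (\<lambda>n::nat. ball 0 (real n)) \<subseteq> Collect open" by auto
  show "(\<Union>n::nat. ball (0::'a) (real n)) = UNIV" using reals_Archimedean2 by auto
  show "emeasure (distr lborel borel f) (ball 0 (real n)) \<noteq> \<infinity>" for n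
    using emeasure_orthogonal_vimage_open[OF f, of "ball 0 (real n)"]
    by (simp add: emeasure_distr emeasure_ball)
qed (simp_all add: borel_def)

lemma nn_integral_rotation_mean:
  fixes F :: "complex \<Rightarrow> ennreal"
  assumes [measurable]: "F \<in> borel_measurable borel"
  shows "ennreal (2*pi) * (\<integral>\<^sup>+z. F z \<partial>lborel) = (\<integral>\<^sup>+z. (\<integral>\<^sup>+t\<in>{0..2*pi}. F (z * cis t) \<partial>lborel) \<partial>lborel)"
proof -
  have rot: "(\<integral>\<^sup>+z. F (z * cis t) \<partial>lborel) = (\<integral>\<^sup>+z. F z \<partial>lborel)" for t
  proof -
    have "orthogonal_transformation (\<lambda>z. z * cis t)"
      by (auto simp: orthogonal_transformation norm_mult bounded_linear_mult_left bounded_linear.linear)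
    from distr_lborel_orthogonal_transformation[OF this]
    show ?thesis using nn_integral_distr[of "\<lambda>z. z * cis t" lborel borel F] by simp
  qed
  have [measurable]: "cis \<in> borel_measurable borel"
    by (intro borel_measurable_continuous_onI continuous_intros)
  have "ennreal (2*pi) * (\<integral>\<^sup>+z. F z \<partial>lborel) = (\<integral>\<^sup>+t. (\<integral>\<^sup>+z. F (z * cis t) * indicator {0..2*pi} t \<partial>lborel) \<partial>lborel)"
    by (simp add: nn_integral_multc rot nn_integral_cmult mult.commute)
  also have "\<dots> = (\<integral>\<^sup>+z. (\<integral>\<^sup>+t\<in>{0..2*pi}. F (z * cis t) \<partial>lborel) \<partial>lborel)"
    by (rule lborel_pair.Fubini') measurable
  finally show ?thesis .
qed

lemma distr_lborel_cmod_square: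
  "distr lborel borel (\<lambda>z::complex. (cmod z)\<^sup>2) = density lborel (\<lambda>s. ennreal pi * indicator {0..} s)"
  (is "?M = ?N")
proof (rule measure_eqI_generator_eq)
  have M: "emeasure ?M {..x} = ennreal (pi * max 0 x)" for x
  proof (cases "0 \<le> x")
    case True
    then have "(\<lambda>z::complex. (cmod z)\<^sup>2) -` {..x} = cball 0 (sqrt x)"
      by (auto simp: real_le_rsqrt sqrt_ge_absD[of "cmod _"])
    then show ?thesis using True by (simp add: emeasure_distr emeasure_cball eval_unit_ball_vol)
  next
    case False
    then have "(\<lambda>z::complex. (cmod z)\<^sup>2) -` {..x} = {}"
      using order_trans[OF zero_le_power2] by fastforce
    then show ?thesis using False by (simp add: emeasure_distr)
  qed
  have N: "emeasure ?N {..x} = ennreal (pi * max 0 x)" for x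
  proof -
    have "emeasure ?N {..x} = (\<integral>\<^sup>+s. ennreal pi * indicator {0..x} s \<partial>lborel)"
      by (auto simp: emeasure_density indicator_def intro!: nn_integral_cong)
    then show ?thesis by (simp add: nn_integral_cmult ennreal_mult' max_def)
  qed
  show "Int_stable (range (\<lambda>x::real. {..x}))" by (auto simp: Int_stable_def)
  show "emeasure ?M X = emeasure ?N X" if "X \<in> range (\<lambda>x. {..x})" for X
    using that M N by auto
  show "range (\<lambda>n::nat. {..real n}) \<subseteq> range (\<lambda>x. {..x})" by auto
  show "(\<Union>n::nat. {..real n}) = UNIV" using real_arch_simple by auto
  show "emeasure ?M {..real n} \<noteq> \<infinity>" for n by (simp add: M)
qed (simp_all add: borel_eq_atMost)

lemma nn_integral_cmod_square:
  fixes F :: "real \<Rightarrow> ennreal"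
  assumes [measurable]: "F \<in> borel_measurable borel"
  shows "(\<integral>\<^sup>+z. F ((cmod z)\<^sup>2) \<partial>lborel) = ennreal pi * (\<integral>\<^sup>+s\<in>{0..}. F s \<partial>lborel)"
proof -
  have "(\<integral>\<^sup>+z. F ((cmod z)\<^sup>2) \<partial>lborel) = (\<integral>\<^sup>+s. F s \<partial>distr lborel borel (\<lambda>z::complex. (cmod z)\<^sup>2))"
    by (simp add: nn_integral_distr)
  also have "\<dots> = ennreal pi * (\<integral>\<^sup>+s\<in>{0..}. F s \<partial>lborel)"
    unfolding distr_lborel_cmod_square by (simp add: nn_integral_density nn_integral_cmult[symmetric] mult_ac)
  finally show ?thesis .
qed

section \<open>The weighted Bergman spaces\<close>

lemma Beta_Suc_eq_kernel_weight:
  assumes "\<alpha> > -1"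
  shows "Beta (real (Suc n)) (\<alpha> + 1) = 1 / ((\<alpha> + 1) * kernel_weight (\<alpha> + 2) n)"
proof -
  have nonpole: "\<alpha> + 2 \<notin> \<int>\<^sub>\<le>\<^sub>0" "\<alpha> + 1 \<notin> \<int>\<^sub>\<le>\<^sub>0" using assms by (auto elim!: nonpos_Ints_cases)
  have "pochhammer (\<alpha> + 2) n * Gamma (\<alpha> + 2) = Gamma (\<alpha> + 2 + real n)"
    using pochhammer_Gamma[OF nonpole(1), of n] nonpole(1) by (simp add: Gamma_eq_zero_iff)
  moreover have "Gamma (\<alpha> + 2) = (\<alpha> + 1) * Gamma (\<alpha> + 1)"
    using Gamma_plus1[OF nonpole(2)] by (simp add: add.assoc)
  moreover have "Gamma (real (Suc n)) = fact n"
    using Gamma_fact[of n, where ?'a = real] by (simp add: add.commute)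
  moreover have "real (Suc n) + (\<alpha> + 1) = \<alpha> + 2 + real n" by simp
  ultimately have "Beta (real (Suc n)) (\<alpha> + 1) =
      fact n * Gamma (\<alpha> + 1) / (pochhammer (\<alpha> + 2) n * ((\<alpha> + 1) * Gamma (\<alpha> + 1)))"
    unfolding Beta_def by (simp only:)
  moreover have "0 < Gamma (\<alpha> + 1)" using assms by simp
  ultimately show ?thesis by (simp add: kernel_weight_def)
qed

lemma nn_integral_bergman_monomial:
  assumes \<alpha>: "\<alpha> > -1"
  shows "(\<integral>\<^sup>+z\<in>ball (0::complex) 1. ennreal (cmod z ^ (2 * n) * (1 - (cmod z)\<^sup>2) powr \<alpha>) \<partial>lborel) =
    ennreal (pi / ((\<alpha> + 1) * kernel_weight (\<alpha> + 2) n))"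
proof -
  let ?F = "\<lambda>s. ennreal (s ^ n * (1 - s) powr \<alpha>) * indicator {0..<1} s"
  have "(\<integral>\<^sup>+z\<in>ball (0::complex) 1. ennreal (cmod z ^ (2 * n) * (1 - (cmod z)\<^sup>2) powr \<alpha>) \<partial>lborel) =
      (\<integral>\<^sup>+z. ?F ((cmod z)\<^sup>2) \<partial>lborel)"
    by (intro nn_integral_cong) (auto simp: indicator_def power_mult abs_square_less_1)
  also have "\<dots> = ennreal pi * (\<integral>\<^sup>+s\<in>{0..}. ?F s \<partial>lborel)"
    by (rule nn_integral_cmod_square) measurable
  also have "(\<integral>\<^sup>+s\<in>{0..}. ?F s \<partial>lborel) =
      (\<integral>\<^sup>+s\<in>{0..1}. ennreal (s powr (real (Suc n) - 1) * (1 - s) powr (\<alpha> + 1 - 1)) \<partial>lborel)"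
  proof (rule nn_integral_cong_AE)
    show "AE s in lborel. ?F s * indicator {0..} s =
        ennreal (s powr (real (Suc n) - 1) * (1 - s) powr (\<alpha> + 1 - 1)) * indicator {0..1} s"
      using AE_lborel_singleton[of "0::real"] AE_lborel_singleton[of "1::real"]
      by eventually_elim (auto simp: indicator_def powr_realpow)
  qed
  also have "\<dots> = ennreal (Beta (real (Suc n)) (\<alpha> + 1))"
    using \<alpha> by (intro nn_integral_has_integral_lebesgue' has_integral_Beta_real) auto
  also have "ennreal pi * \<dots> = ennreal (pi / ((\<alpha> + 1) * kernel_weight (\<alpha> + 2) n))"
    unfolding Beta_Suc_eq_kernel_weight[OF \<alpha>] by (simp flip: ennreal_mult')
  finally show ?thesis .
qed

lemma borel_measurable_bergman_weight:
  assumes "f holomorphic_on ball 0 1"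
  shows "(\<lambda>z. indicator (ball 0 1) z *\<^sub>R bergman_weight_fun \<alpha> f z) \<in> borel_measurable borel"
proof (rule borel_measurable_continuous_on_indicator)
  have "1 - (cmod z)\<^sup>2 \<noteq> 0" if "cmod z < 1" for z using one_minus_norm_square_pos[OF that] by simp
  then show "continuous_on (ball 0 1) (bergman_weight_fun \<alpha> f)"
    unfolding bergman_weight_fun_def
    by (intro continuous_intros holomorphic_on_imp_continuous_on[OF assms]) auto
qed simp

lemma nn_integral_bergman_weight_circle:
  assumes a: "disc_series a f" and z: "cmod z < 1"
  shows "(\<integral>\<^sup>+t\<in>{0..2*pi}. ennreal (bergman_weight_fun \<alpha> f (z * cis t)) \<partial>lborel) =
    ennreal (2 * pi) * (\<Sum>n. ennreal ((cmod (a n))\<^sup>2 * (cmod z ^ (2 * n) * (1 - (cmod z)\<^sup>2) powr \<alpha>)))"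
proof -
  define I where "I = integral {0..2*pi} (\<lambda>t. (cmod (f (z * cis t)))\<^sup>2)"
  have hol: "f holomorphic_on ball 0 1" using a holomorphic_on_iff_disc_series by blast
  have "continuous_on {0..2*pi} (\<lambda>t. (cmod (f (z * cis t)))\<^sup>2)"
    using z by (intro continuous_intros continuous_on_compose2[OF holomorphic_on_imp_continuous_on[OF hol]])
      (auto simp: norm_mult)
  then have "((\<lambda>t. (cmod (f (z * cis t)))\<^sup>2 * (1 - (cmod z)\<^sup>2) powr \<alpha>) has_integral
      I * (1 - (cmod z)\<^sup>2) powr \<alpha>) {0..2*pi}"
    unfolding I_def by (intro has_integral_mult_left integrable_integral integrable_continuous_interval)
  then have "(\<integral>\<^sup>+t\<in>{0..2*pi}. ennreal (bergman_weight_fun \<alpha> f (z * cis t)) \<partial>lborel) =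
      ennreal (I * (1 - (cmod z)\<^sup>2) powr \<alpha>)"
    by (intro nn_integral_has_integral_lebesgue') (auto simp: bergman_weight_fun_def norm_mult)
  also have "I * (1 - (cmod z)\<^sup>2) powr \<alpha> = 2 * pi * (I / (2 * pi) * (1 - (cmod z)\<^sup>2) powr \<alpha>)" by simp
  also have "I / (2 * pi) * (1 - (cmod z)\<^sup>2) powr \<alpha> =
      (\<Sum>n. (cmod (a n))\<^sup>2 * (cmod z ^ (2 * n) * (1 - (cmod z)\<^sup>2) powr \<alpha>))"
    using sums_unique[OF sums_mult2[OF disc_series_parseval[OF a z]]] by (simp add: I_def mult.assoc)
  also have "ennreal (2 * pi * \<dots>) =
      ennreal (2 * pi) * (\<Sum>n. ennreal ((cmod (a n))\<^sup>2 * (cmod z ^ (2 * n) * (1 - (cmod z)\<^sup>2) powr \<alpha>)))"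
    using sums_summable[OF sums_mult2[OF disc_series_parseval[OF a z], of "(1 - (cmod z)\<^sup>2) powr \<alpha>"]]
    by (subst suminf_ennreal2) (simp_all add: ennreal_mult' mult.assoc)
  finally show ?thesis .
qed

lemma nn_integral_bergman_weight:
  assumes \<alpha>: "\<alpha> > -1" and a: "disc_series a f"
  shows "(\<integral>\<^sup>+z. ennreal (indicator (ball 0 1) z *\<^sub>R bergman_weight_fun \<alpha> f z) \<partial>lborel) =
    ennreal (pi / (\<alpha> + 1)) * (\<Sum>n. ennreal (weighted_square (\<alpha> + 2) a n))"
proof -
  let ?g = "\<lambda>z. indicator (ball 0 1) z *\<^sub>R bergman_weight_fun \<alpha> f z"
  let ?m = "\<lambda>n z. ennreal (cmod z ^ (2 * n) * (1 - (cmod z)\<^sup>2) powr \<alpha>) * indicator (ball 0 1) z"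
  have "f holomorphic_on ball 0 1" using a holomorphic_on_iff_disc_series by blast
  then have "ennreal (2 * pi) * (\<integral>\<^sup>+z. ennreal (?g z) \<partial>lborel) =
      (\<integral>\<^sup>+z. (\<integral>\<^sup>+t\<in>{0..2*pi}. ennreal (?g (z * cis t)) \<partial>lborel) \<partial>lborel)"
    by (intro nn_integral_rotation_mean measurable_compose[OF borel_measurable_bergman_weight measurable_ennreal])
  also have "\<dots> = (\<integral>\<^sup>+z. ennreal (2 * pi) * (\<Sum>n. ennreal ((cmod (a n))\<^sup>2) * ?m n z) \<partial>lborel)"
  proof (rule nn_integral_cong)
    show "(\<integral>\<^sup>+t\<in>{0..2*pi}. ennreal (?g (z * cis t)) \<partial>lborel) =
        ennreal (2 * pi) * (\<Sum>n. ennreal ((cmod (a n))\<^sup>2) * ?m n z)" for z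
      using nn_integral_bergman_weight_circle[OF a, of z \<alpha>]
      by (cases "cmod z < 1") (auto simp: norm_mult ennreal_mult')
  qed
  also have "\<dots> = ennreal (2 * pi) * (\<Sum>n. ennreal ((cmod (a n))\<^sup>2) * (\<integral>\<^sup>+z. ?m n z \<partial>lborel))"
  proof -
    have [measurable]: "ball (0::complex) 1 \<in> sets borel" by simp
    show ?thesis
      by (subst nn_integral_cmult, measurable, subst nn_integral_suminf, measurable) (simp add: nn_integral_cmult)
  qed
  also have "(\<Sum>n. ennreal ((cmod (a n))\<^sup>2) * (\<integral>\<^sup>+z. ?m n z \<partial>lborel)) =
      (\<Sum>n. ennreal (pi / (\<alpha> + 1)) * ennreal (weighted_square (\<alpha> + 2) a n))"
    unfolding nn_integral_bergman_monomial[OF \<alpha>] weighted_square_def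
    using \<alpha> by (simp add: mult.commute flip: ennreal_mult')
  finally show ?thesis by (simp add: ennreal_mult_cancel_left)
qed

lemma has_bochner_integral_bergman_weight:
  assumes \<alpha>: "\<alpha> > -1" and a: "disc_series a f"
    and S: "weighted_square (\<alpha> + 2) a sums S"
  shows "has_bochner_integral lborel (\<lambda>z. indicator (ball 0 1) z *\<^sub>R bergman_weight_fun \<alpha> f z) (pi / (\<alpha> + 1) * S)"
proof (rule has_bochner_integral_nn_integral)
  have terms_nonneg: "0 \<le> weighted_square (\<alpha> + 2) a n" for n
    using \<alpha> by (intro weighted_square_nonneg) simp
  show "(\<lambda>z. indicator (ball 0 1) z *\<^sub>R bergman_weight_fun \<alpha> f z) \<in> borel_measurable lborel"
    using a borel_measurable_bergman_weight holomorphic_on_iff_disc_series by auto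
  have "(\<Sum>n. ennreal (weighted_square (\<alpha> + 2) a n)) = ennreal S"
    using S terms_nonneg by (simp add: sums_iff suminf_ennreal2)
  then show "(\<integral>\<^sup>+z. ennreal (indicator (ball 0 1) z *\<^sub>R bergman_weight_fun \<alpha> f z) \<partial>lborel) = ennreal (pi / (\<alpha> + 1) * S)"
    unfolding nn_integral_bergman_weight[OF \<alpha> a] using \<alpha> by (simp flip: ennreal_mult')
  have "0 \<le> S" using terms_nonneg by (rule sums_le[OF _ sums_zero S])
  then show "0 \<le> pi / (\<alpha> + 1) * S" using \<alpha> by simp
qed (simp add: bergman_weight_fun_def)

lemma in_A2_iff_summable:
  assumes \<alpha>: "\<alpha> > -1" and a: "disc_series a f"
  shows "in_A2 \<alpha> f \<longleftrightarrow> summable (weighted_square (\<alpha> + 2) a)"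
proof
  assume "in_A2 \<alpha> f"
  then have "integrable lborel (\<lambda>z. indicator (ball 0 1) z *\<^sub>R bergman_weight_fun \<alpha> f z)"
    by (simp add: in_A2_def set_integrable_def)
  then have "(\<integral>\<^sup>+z. ennreal (indicator (ball 0 1) z *\<^sub>R bergman_weight_fun \<alpha> f z) \<partial>lborel) < \<infinity>"
    by (simp add: integrable_iff_bounded bergman_weight_fun_def)
  then have "(\<Sum>n. ennreal (weighted_square (\<alpha> + 2) a n)) \<noteq> top"
    unfolding nn_integral_bergman_weight[OF \<alpha> a] using \<alpha> by (auto simp: ennreal_mult_less_top)
  then show "summable (weighted_square (\<alpha> + 2) a)"
    using \<alpha> by (intro summable_suminf_not_top weighted_square_nonneg) simp_all
next
  assume "summable (weighted_square (\<alpha> + 2) a)"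
  then have "integrable lborel (\<lambda>z. indicator (ball 0 1) z *\<^sub>R bergman_weight_fun \<alpha> f z)"
    using has_bochner_integral_bergman_weight[OF \<alpha> a summable_sums] integrable.intros by blast
  then show "in_A2 \<alpha> f"
    using a unfolding in_A2_def set_integrable_def holomorphic_on_iff_disc_series by blast
qed

lemma weighted_hardy_space_A2:
  assumes \<alpha>: "\<alpha> > -1"
  shows "weighted_hardy_space (\<alpha> + 2) (in_A2 \<alpha>) (A2_norm \<alpha>)"
proof
  show "in_A2 \<alpha> f \<longleftrightarrow> (\<exists>a. disc_series a f \<and> summable (weighted_square (\<alpha> + 2) a))" for f
    using in_A2_iff_summable[OF \<alpha>] by (auto simp: in_A2_def holomorphic_on_iff_disc_series)
  show "A2_norm \<alpha> f = sqrt S"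
    if "disc_series a f" "weighted_square (\<alpha> + 2) a sums S" for a f S
    using has_bochner_integral_integral_eq[OF has_bochner_integral_bergman_weight[OF \<alpha> that]] \<alpha>
    by (simp add: A2_norm_def set_lebesgue_integral_def)
qed (use \<alpha> in simp)

section \<open>Linear-fractional self-maps in half-plane coordinates\<close>

text \<open>The disc is mapped onto the right half-plane and \<open>\<zeta>\<close> to infinity; the junk value at \<open>\<zeta>\<close> itself is \<open>0\<close>.\<close>

definition cayley :: "complex \<Rightarrow> complex \<Rightarrow> complex" where
  "cayley \<zeta> z = (\<zeta> + z) / (\<zeta> - z)"

lemma cayley_plus_one:
  assumes "z \<noteq> \<zeta>"
  shows "cayley \<zeta> z + 1 = 2 * \<zeta> / (\<zeta> - z)"
  using assms by (simp add: cayley_def field_simps)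

lemma Re_cayley:
  assumes "cmod \<zeta> = 1"
  shows "Re (cayley \<zeta> z) = (1 - (cmod z)\<^sup>2) / (cmod (\<zeta> - z))\<^sup>2"
proof -
  have "Re ((\<zeta> + z) * cnj (\<zeta> - z)) = (cmod \<zeta>)\<^sup>2 - (cmod z)\<^sup>2"
    unfolding cmod_power2 by (simp add: algebra_simps power2_eq_square)
  then show ?thesis
    using assms unfolding cayley_def by (subst complex_div_cnj) (simp flip: of_real_power)
qed

lemma Re_cayley_pos_iff:
  assumes "cmod \<zeta> = 1"
  shows "0 < Re (cayley \<zeta> z) \<longleftrightarrow> cmod z < 1"
  unfolding Re_cayley[OF assms] using assms by (auto simp: zero_less_divide_iff abs_square_less_1)

lemma cayley_surj:
  assumes "cmod \<zeta> = 1" "0 < Re u"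
  obtains z where "cmod z < 1" "cayley \<zeta> z = u"
proof -
  define z where "z = \<zeta> * (u - 1) / (u + 1)"
  have "\<zeta> \<noteq> 0" using assms(1) by auto
  moreover have "u + 1 \<noteq> 0" using assms(2) by (auto simp: complex_eq_iff)
  ultimately have "\<zeta> + z = 2 * \<zeta> * u / (u + 1)" "\<zeta> - z = 2 * \<zeta> / (u + 1)"
    by (simp_all add: z_def field_simps)
  then have "cayley \<zeta> z = u" using \<open>\<zeta> \<noteq> 0\<close> \<open>u + 1 \<noteq> 0\<close> by (simp add: cayley_def)
  moreover from this have "cmod z < 1" using assms Re_cayley_pos_iff by blast
  ultimately show ?thesis using that by blast
qed

lemma cayley_inj:
  assumes "cmod \<zeta> = 1" "cmod z < 1" "cmod w < 1" "cayley \<zeta> z = cayley \<zeta> w"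
  shows "z = w"
proof -
  have "z \<noteq> \<zeta>" "w \<noteq> \<zeta>" "\<zeta> \<noteq> 0" using assms(1-3) by auto
  then have "2 * \<zeta> / (\<zeta> - z) = 2 * \<zeta> / (\<zeta> - w)"
    using assms(4) by (simp flip: cayley_plus_one)
  then show ?thesis using \<open>z \<noteq> \<zeta>\<close> \<open>w \<noteq> \<zeta>\<close> \<open>\<zeta> \<noteq> 0\<close> by simp
qed

lemma one_minus_norm_square_cayley:
  assumes "cmod \<zeta> = 1" "cmod z < 1"
  shows "1 - (cmod z)\<^sup>2 = 4 * Re (cayley \<zeta> z) / (cmod (cayley \<zeta> z + 1))\<^sup>2"
proof -
  have "z \<noteq> \<zeta>" using assms by auto
  then show ?thesis
    using assms(1) by (simp add: cayley_plus_one Re_cayley norm_divide norm_mult power_divide power_mult_distrib)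
qed

lemma pseudohyperbolic_dist_cayley:
  assumes \<zeta>: "cmod \<zeta> = 1" and z: "cmod z < 1" and w: "cmod w < 1"
  shows "pseudohyperbolic_dist z w =
    cmod (cayley \<zeta> z - cayley \<zeta> w) / cmod (cayley \<zeta> z + cnj (cayley \<zeta> w))"
proof -
  have ne: "\<zeta> - z \<noteq> 0" "\<zeta> - w \<noteq> 0" "cnj \<zeta> - cnj w \<noteq> 0" using assms by (auto simp flip: complex_cnj_diff)
  have \<zeta>\<zeta>: "\<zeta> * cnj \<zeta> = 1" using \<zeta> complex_norm_square[of \<zeta>] by simp
  have diff: "cayley \<zeta> z - cayley \<zeta> w = 2 * \<zeta> * (z - w) / ((\<zeta> - z) * (\<zeta> - w))"
    using ne by (simp add: cayley_def field_simps)
  have "cayley \<zeta> z + cnj (cayley \<zeta> w) =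
      ((\<zeta> + z) * (cnj \<zeta> - cnj w) + (cnj \<zeta> + cnj w) * (\<zeta> - z)) / ((\<zeta> - z) * cnj (\<zeta> - w))"
    using ne by (simp add: cayley_def add_frac_eq)
  also have "(\<zeta> + z) * (cnj \<zeta> - cnj w) + (cnj \<zeta> + cnj w) * (\<zeta> - z) = 2 * (\<zeta> * cnj \<zeta> - cnj w * z)"
    by (simp add: algebra_simps)
  finally have sum: "cayley \<zeta> z + cnj (cayley \<zeta> w) = 2 * (1 - cnj w * z) / ((\<zeta> - z) * cnj (\<zeta> - w))"
    by (simp only: \<zeta>\<zeta>)
  have "cmod (cnj (\<zeta> - w)) = cmod (\<zeta> - w)" by (rule complex_mod_cnj)
  then show ?thesis
    unfolding diff sum pseudohyperbolic_dist_def norm_mult norm_divide using \<zeta> ne by simp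
qed

lemma lf_selfmap_disc: "lf_selfmap \<phi> \<Longrightarrow> cmod z < 1 \<Longrightarrow> cmod (\<phi> z) < 1"
  unfolding lf_selfmap_def image_subset_iff by auto

text \<open>Since \<open>x / 0 = 0\<close>, the value of \<open>\<phi>\<close> at a pole lies in the disc; only the values nearby rule a pole out.\<close>

lemma lf_denominator_nonzero:
  assumes det: "a * d - b * c \<noteq> 0" and \<phi>: "\<And>z. \<phi> z = (a * z + b) / (c * z + d)"
    and self: "\<phi> ` ball 0 1 \<subseteq> ball 0 1" and z: "cmod z < 1"
  shows "c * z + d \<noteq> 0"
proof
  assume pole: "c * z + d = 0"
  then have c: "c \<noteq> 0" using det by auto
  have "cmod (a * x + b) \<le> cmod (c * x + d)" if "x \<in> ball 0 1 - {z}" for x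
  proof -
    have "c * x + d = c * (x - z) + (c * z + d)" by (simp add: algebra_simps)
    then have "c * x + d \<noteq> 0" using c pole that by simp
    moreover have "cmod (\<phi> x) < 1" using self that by (auto simp: image_subset_iff)
    ultimately show ?thesis by (simp add: \<phi> norm_divide)
  qed
  moreover have "\<forall>\<^sub>F x in at z. x \<in> ball 0 1 - {z}"
    using z by (intro eventually_at_in_open) auto
  ultimately have le_near: "\<forall>\<^sub>F x in at z. cmod (a * x + b) \<le> cmod (c * x + d)"
    by (rule eventually_mono[rotated])
  have "((\<lambda>x. cmod (a * x + b)) \<longlongrightarrow> cmod (a * z + b)) (at z)"
    and "((\<lambda>x. cmod (c * x + d)) \<longlongrightarrow> cmod (c * z + d)) (at z)"
    by (intro tendsto_intros)+
  then have "cmod (a * z + b) \<le> cmod (c * z + d)"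
    using le_near tendsto_le trivial_limit_at by blast
  then have "a * z + b = 0" using pole by simp
  moreover have "a * d - b * c = a * (c * z + d) - c * (a * z + b)" by (simp add: algebra_simps)
  ultimately show False using det pole by simp
qed

lemma deriv_linear_fractional:
  assumes "c * z + d \<noteq> 0"
  shows "deriv (\<lambda>z. (a * z + b) / (c * z + d)) z = (a * d - b * c) / (c * z + d)\<^sup>2"
proof -
  have "((\<lambda>z. (a * z + b) / (c * z + d)) has_field_derivative
      (a * (c * z + d) - (a * z + b) * c) / ((c * z + d) * (c * z + d))) (at z)"
    using assms by (auto intro!: derivative_eq_intros)
  then show ?thesis by (simp add: DERIV_imp_deriv power2_eq_square algebra_simps)
qed

lemma cayley_linear_fractional:
  assumes fixp: "a * \<zeta> + b = \<eta> * (c * \<zeta> + d)" and ne: "\<zeta> \<noteq> 0" "a - \<eta> * c \<noteq> 0" "c * z + d \<noteq> 0"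
    and z: "z \<noteq> \<zeta>"
  shows "cayley \<eta> ((a * z + b) / (c * z + d)) =
    \<eta> * (c * \<zeta> + d) / (\<zeta> * (a - \<eta> * c)) * cayley \<zeta> z +
    (\<eta> * d + b - (\<eta> * c + a) * \<zeta>) / (2 * \<zeta> * (a - \<eta> * c))"
proof -
  define \<kappa> where "\<kappa> = a - \<eta> * c"
  have "cayley \<eta> ((a * z + b) / (c * z + d)) = (\<eta> * (c * z + d) + (a * z + b)) / (\<eta> * (c * z + d) - (a * z + b))"
    using ne by (simp add: cayley_def add_divide_eq_iff diff_divide_eq_iff)
  also have "\<eta> * (c * z + d) - (a * z + b) = \<kappa> * (\<zeta> - z)"
    using fixp by (simp add: \<kappa>_def algebra_simps)
  also have "(\<eta> * (c * z + d) + (a * z + b)) / (\<kappa> * (\<zeta> - z)) =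
      (2 * \<zeta> * (\<eta> * (c * z + d) + (a * z + b))) / (2 * \<zeta> * \<kappa> * (\<zeta> - z))"
    using ne by simp
  also have "2 * \<zeta> * (\<eta> * (c * z + d) + (a * z + b)) =
      (\<eta> * (c * \<zeta> + d) + (a * \<zeta> + b)) * (\<zeta> + z) + (\<eta> * d + b - (\<eta> * c + a) * \<zeta>) * (\<zeta> - z)"
    by (simp add: algebra_simps)
  also have "\<dots> / (2 * \<zeta> * \<kappa> * (\<zeta> - z)) =
      \<eta> * (c * \<zeta> + d) / (\<zeta> * \<kappa>) * cayley \<zeta> z + (\<eta> * d + b - (\<eta> * c + a) * \<zeta>) / (2 * \<zeta> * \<kappa>)"
    using z ne by (simp add: fixp cayley_def mult.assoc add_divide_distrib[of _ "_ * (\<zeta> - z)"] flip: \<kappa>_def)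
  finally show ?thesis by (simp add: \<kappa>_def)
qed

lemma half_plane_affine_slope:
  fixes s e :: complex
  assumes half_plane: "\<And>u. 0 < Re u \<Longrightarrow> 0 < Re (s * u + e)" and "s \<noteq> 0"
  obtains t where "0 < t" "s = of_real t"
proof -
  have "0 \<le> Re s"
  proof (rule ccontr)
    assume "\<not> 0 \<le> Re s"
    then have neg: "Re s < 0" by simp
    define t where "t = (\<bar>Re e\<bar> + 1) / (- Re s)"
    have "0 < t" using neg unfolding t_def by (intro divide_pos_pos) auto
    then have "0 < Re s * t + Re e" using half_plane[of "of_real t"] by simp
    moreover have "Re s * t = - (\<bar>Re e\<bar> + 1)" using neg by (simp add: t_def)
    ultimately show False by linarith
  qed
  moreover have "Im s = 0"
  proof (rule ccontr)
    assume nz: "Im s \<noteq> 0"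
    define t where "t = (\<bar>Re e\<bar> + Re s + 1) / Im s"
    have "0 < Re s - Im s * t + Re e" using half_plane[of "Complex 1 t"] by simp
    moreover have "Im s * t = \<bar>Re e\<bar> + Re s + 1" using nz by (simp add: t_def)
    ultimately show False by linarith
  qed
  ultimately show ?thesis using that[of "Re s"] \<open>s \<noteq> 0\<close> by (auto simp: complex_eq_iff)
qed

lemma lf_selfmap_cayley:
  assumes lf: "lf_selfmap \<phi>" and \<zeta>: "cmod \<zeta> = 1" and \<eta>: "cmod (\<phi> \<zeta>) = 1"
  obtains e s where "s > 0" "\<phi> \<zeta> = of_real s * \<zeta> * deriv \<phi> \<zeta>"
    "\<And>z. cmod z < 1 \<Longrightarrow> cayley (\<phi> \<zeta>) (\<phi> z) = of_real s * cayley \<zeta> z + e"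
proof -
  from lf obtain a b c d where det: "a * d - b * c \<noteq> 0" and \<phi>: "\<And>z. \<phi> z = (a * z + b) / (c * z + d)"
    and self: "\<phi> ` ball 0 1 \<subseteq> ball 0 1" unfolding lf_selfmap_def by blast
  define \<kappa> where "\<kappa> = a - \<phi> \<zeta> * c"
  define s where "s = \<phi> \<zeta> * (c * \<zeta> + d) / (\<zeta> * \<kappa>)"
  define e where "e = (\<phi> \<zeta> * d + b - (\<phi> \<zeta> * c + a) * \<zeta>) / (2 * \<zeta> * \<kappa>)"
  have "\<zeta> \<noteq> 0" "\<phi> \<zeta> \<noteq> 0" using \<zeta> \<eta> by auto
  then have den: "c * \<zeta> + d \<noteq> 0" using \<phi>[of \<zeta>] by auto
  then have fixp: "a * \<zeta> + b = \<phi> \<zeta> * (c * \<zeta> + d)" using \<phi>[of \<zeta>] by simp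
  have "\<kappa> * (c * \<zeta> + d) = a * (c * \<zeta> + d) - c * (a * \<zeta> + b)"
    unfolding fixp \<kappa>_def by (simp add: algebra_simps)
  then have det_eq: "\<kappa> * (c * \<zeta> + d) = a * d - b * c" by (simp add: algebra_simps)
  then have "\<kappa> \<noteq> 0" using det by auto
  have affine: "cayley (\<phi> \<zeta>) (\<phi> z) = s * cayley \<zeta> z + e" if "cmod z < 1" for z
    unfolding s_def e_def \<kappa>_def \<phi>[of z]
    using that \<zeta> \<open>\<zeta> \<noteq> 0\<close> \<open>\<kappa> \<noteq> 0\<close> lf_denominator_nonzero[OF det \<phi> self that]
    by (intro cayley_linear_fractional fixp) (auto simp: \<kappa>_def)
  have "0 < Re (s * u + e)" if u: "0 < Re u" for u
  proof -
    obtain z where z: "cmod z < 1" "cayley \<zeta> z = u" using cayley_surj[OF \<zeta> u] .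
    then have "cmod (\<phi> z) < 1" using self by (auto simp: image_subset_iff)
    then show ?thesis using affine[OF z(1)] z(2) Re_cayley_pos_iff[OF \<eta>] by metis
  qed
  moreover have "s \<noteq> 0"
    using den \<open>\<zeta> \<noteq> 0\<close> \<open>\<phi> \<zeta> \<noteq> 0\<close> \<open>\<kappa> \<noteq> 0\<close> by (simp add: s_def)
  ultimately obtain t where t: "0 < t" "s = of_real t" by (rule half_plane_affine_slope)
  have "\<phi> = (\<lambda>z. (a * z + b) / (c * z + d))" using \<phi> by (simp add: fun_eq_iff)
  then have "deriv \<phi> \<zeta> = \<kappa> / (c * \<zeta> + d)"
    using deriv_linear_fractional[OF den, of a b] den by (simp add: power2_eq_square flip: det_eq)
  then have "\<phi> \<zeta> = s * \<zeta> * deriv \<phi> \<zeta>"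
    using den \<open>\<zeta> \<noteq> 0\<close> \<open>\<kappa> \<noteq> 0\<close> by (simp add: s_def)
  with that[of t e] t affine show ?thesis by simp
qed

lemma one_minus_norm_square_horocycle_le:
  assumes \<zeta>: "cmod \<zeta> = 1" and \<eta>: "cmod \<eta> = 1" and s: "s > 0"
    and z: "cmod z < 1" "Re (cayley \<zeta> z) = 1" and y: "cmod y < 1" "cayley \<eta> y = of_real s * cayley \<zeta> z + e"
  shows "1 - (cmod y)\<^sup>2 \<le> (s + Re e) * ((1 + cmod (of_real s - e - 1)) / s)\<^sup>2 * (1 - (cmod z)\<^sup>2)"
proof -
  define u where "u = cayley \<zeta> z"
  define p where "p = of_real s * u + e"
  define M where "M = 1 + cmod (of_real s - e - 1)"
  have Re_p: "Re p = s + Re e" using z by (simp add: p_def u_def)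
  have "0 < Re p" using Re_cayley_pos_iff[OF \<eta>, of y] y by (simp add: p_def u_def)
  then have one_le: "1 \<le> cmod (p + 1)" using complex_Re_le_cmod[of "p + 1"] by simp
  have "u + 1 \<noteq> 0" "p + 1 \<noteq> 0" using z \<open>0 < Re p\<close> by (auto simp: u_def complex_eq_iff)
  have "s * cmod (u + 1) = cmod (of_real s * (u + 1))" using s by (simp add: norm_mult)
  also have "of_real s * (u + 1) = (p + 1) + (of_real s - e - 1)" by (simp add: p_def algebra_simps)
  also have "cmod \<dots> \<le> cmod (p + 1) + cmod (of_real s - e - 1)" by (rule norm_triangle_ineq)
  also have "\<dots> \<le> M * cmod (p + 1)"
    using mult_left_mono[OF one_le norm_ge_zero[of "of_real s - e - 1"]] by (simp add: M_def algebra_simps)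
  finally have "1 / cmod (p + 1) \<le> M / s * (1 / cmod (u + 1))"
    using s \<open>u + 1 \<noteq> 0\<close> \<open>p + 1 \<noteq> 0\<close> by (simp add: pos_le_divide_eq pos_divide_le_eq mult_ac)
  then have "(1 / cmod (p + 1))\<^sup>2 \<le> (M / s * (1 / cmod (u + 1)))\<^sup>2"
    by (rule power_mono) simp
  then have p_le: "4 * Re p * (1 / cmod (p + 1))\<^sup>2 \<le> 4 * Re p * (M / s * (1 / cmod (u + 1)))\<^sup>2"
    using \<open>0 < Re p\<close> by (intro mult_left_mono) auto
  have "1 - (cmod y)\<^sup>2 = 4 * Re p * (1 / cmod (p + 1))\<^sup>2"
    using one_minus_norm_square_cayley[OF \<eta> y(1)] by (simp add: y(2) p_def u_def power_divide)
  also note p_le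
  also have "4 * Re p * (M / s * (1 / cmod (u + 1)))\<^sup>2 = (s + Re e) * (M / s)\<^sup>2 * (4 * (1 / cmod (u + 1))\<^sup>2)"
    by (simp only: Re_p power_mult_distrib mult_ac)
  also have "4 * (1 / cmod (u + 1))\<^sup>2 = 1 - (cmod z)\<^sup>2"
    using one_minus_norm_square_cayley[OF \<zeta> z(1)] by (simp add: z(2) u_def power_divide)
  finally show ?thesis unfolding M_def .
qed

lemma horocycle_sequence:
  assumes \<zeta>: "cmod \<zeta> = 1"
  obtains w where "\<And>k. cmod (w k) < 1" "\<And>k. Re (cayley \<zeta> (w k)) = 1" "(\<lambda>k. 1 - (cmod (w k))\<^sup>2) \<longlonglongrightarrow> 0"
proof -
  have "\<exists>z. cmod z < 1 \<and> cayley \<zeta> z = Complex 1 (real k)" for k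
    using cayley_surj[OF \<zeta>, of "Complex 1 (real k)"] by auto
  then obtain w where w: "\<And>k. cmod (w k) < 1" "\<And>k. cayley \<zeta> (w k) = Complex 1 (real k)" by metis
  have "1 - (cmod (w k))\<^sup>2 = 4 / (4 + (real k)\<^sup>2)" for k
    using one_minus_norm_square_cayley[OF \<zeta> w(1)] w(2) by (simp add: cmod_power2)
  moreover have "(\<lambda>k. 4 / (4 + (real k)\<^sup>2)) \<longlonglongrightarrow> 0" by real_asymp
  ultimately show ?thesis using that[of w] w by simp
qed

lemma pseudohyperbolic_dist_horocycle:
  assumes \<eta>: "cmod \<eta> = 1" and z: "cmod z < 1" and w: "cmod w < 1" and u: "Re u = 1"
    and coords: "cayley \<eta> z = of_real s * u + a" "cayley \<eta> w = of_real s * u + b"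
  shows "pseudohyperbolic_dist z w = cmod (a - b) / cmod (2 * of_real s + a + cnj b)"
proof -
  have "u + cnj u = 2" using u by (simp add: complex_add_cnj)
  moreover have "of_real s * u + a + cnj (of_real s * u + b) = of_real s * (u + cnj u) + a + cnj b"
    by (simp add: algebra_simps)
  ultimately have sum: "cayley \<eta> z + cnj (cayley \<eta> w) = 2 * of_real s + a + cnj b"
    unfolding coords by (simp only: mult.commute)
  have diff: "cayley \<eta> z - cayley \<eta> w = a - b" by (simp add: coords)
  show ?thesis unfolding pseudohyperbolic_dist_cayley[OF \<eta> z w] sum diff ..
qed

lemma lf_selfmaps_same_derivative_cayley:
  assumes \<phi>: "lf_selfmap \<phi>" and \<psi>: "lf_selfmap \<psi>" and \<zeta>: "cmod \<zeta> = 1"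
    and eq: "\<phi> \<zeta> = \<psi> \<zeta>" and \<eta>: "cmod (\<phi> \<zeta>) = 1" and der: "deriv \<phi> \<zeta> = deriv \<psi> \<zeta>"
    and ne: "\<exists>z\<in>ball 0 1. \<phi> z \<noteq> \<psi> z"
  obtains s a b where "s > 0" "a \<noteq> b"
    "\<And>z. cmod z < 1 \<Longrightarrow> cayley (\<phi> \<zeta>) (\<phi> z) = of_real s * cayley \<zeta> z + a"
    "\<And>z. cmod z < 1 \<Longrightarrow> cayley (\<phi> \<zeta>) (\<psi> z) = of_real s * cayley \<zeta> z + b"
proof -
  obtain s a where s: "s > 0" "\<phi> \<zeta> = of_real s * \<zeta> * deriv \<phi> \<zeta>"
    and a: "\<And>z. cmod z < 1 \<Longrightarrow> cayley (\<phi> \<zeta>) (\<phi> z) = of_real s * cayley \<zeta> z + a"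
    using lf_selfmap_cayley[OF \<phi> \<zeta> \<eta>] by blast
  obtain s' b where s': "\<phi> \<zeta> = of_real s' * \<zeta> * deriv \<phi> \<zeta>"
    and b: "\<And>z. cmod z < 1 \<Longrightarrow> cayley (\<phi> \<zeta>) (\<psi> z) = of_real s' * cayley \<zeta> z + b"
    using lf_selfmap_cayley[OF \<psi> \<zeta>] \<eta> eq der by metis
  have "\<phi> \<zeta> \<noteq> 0" using \<eta> by auto
  then have "s' = s" using s(2) s' by (metis mult_cancel_right mult_zero_right mult_zero_left of_real_eq_iff)
  obtain z where z: "cmod z < 1" "\<phi> z \<noteq> \<psi> z" using ne by auto
  have "cayley (\<phi> \<zeta>) (\<phi> z) \<noteq> cayley (\<phi> \<zeta>) (\<psi> z)"
    using cayley_inj[OF \<eta> lf_selfmap_disc[OF \<phi> z(1)] lf_selfmap_disc[OF \<psi> z(1)]] z(2) by blast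
  then have "a \<noteq> b" using a[OF z(1)] b[OF z(1)] \<open>s' = s\<close> by auto
  with that[OF s(1)] a b \<open>s' = s\<close> show ?thesis by blast
qed

lemma lf_selfmaps_separated_on_horocycle:
  assumes \<phi>: "lf_selfmap \<phi>" and \<psi>: "lf_selfmap \<psi>" and \<zeta>: "cmod \<zeta> = 1"
    and eq: "\<phi> \<zeta> = \<psi> \<zeta>" and \<eta>: "cmod (\<phi> \<zeta>) = 1" and der: "deriv \<phi> \<zeta> = deriv \<psi> \<zeta>"
    and ne: "\<exists>z\<in>ball 0 1. \<phi> z \<noteq> \<psi> z"
  obtains C \<delta> where "0 < \<delta>"
    "\<And>z. cmod z < 1 \<Longrightarrow> Re (cayley \<zeta> z) = 1 \<Longrightarrow> 1 - (cmod (\<phi> z))\<^sup>2 \<le> C * (1 - (cmod z)\<^sup>2)"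
    "\<And>z. cmod z < 1 \<Longrightarrow> Re (cayley \<zeta> z) = 1 \<Longrightarrow> 1 - (cmod (\<psi> z))\<^sup>2 \<le> C * (1 - (cmod z)\<^sup>2)"
    "\<And>z. cmod z < 1 \<Longrightarrow> Re (cayley \<zeta> z) = 1 \<Longrightarrow> pseudohyperbolic_dist (\<phi> z) (\<psi> z) = \<delta>"
proof -
  let ?\<eta> = "\<phi> \<zeta>"
  note \<phi>_disc = lf_selfmap_disc[OF \<phi>] and \<psi>_disc = lf_selfmap_disc[OF \<psi>]
  obtain s a b where s: "s > 0" and "a \<noteq> b"
    and a: "\<And>z. cmod z < 1 \<Longrightarrow> cayley ?\<eta> (\<phi> z) = of_real s * cayley \<zeta> z + a"
    and b: "\<And>z. cmod z < 1 \<Longrightarrow> cayley ?\<eta> (\<psi> z) = of_real s * cayley \<zeta> z + b"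
    using lf_selfmaps_same_derivative_cayley[OF assms] by blast
  have "0 < Re (2 * of_real s + a + cnj b)"
  proof -
    obtain z where z: "cmod z < 1" "cayley \<zeta> z = 1" using cayley_surj[OF \<zeta>, of 1] by auto
    have "0 < Re (cayley ?\<eta> (\<phi> z))" "0 < Re (cayley ?\<eta> (\<psi> z))"
      using Re_cayley_pos_iff[OF \<eta>] \<phi>_disc[OF z(1)] \<psi>_disc[OF z(1)] by auto
    then show ?thesis by (simp add: a[OF z(1)] b[OF z(1)] z(2))
  qed
  then have "2 * of_real s + a + cnj b \<noteq> 0" by (metis less_irrefl zero_complex.simps(1))
  then have \<delta>: "0 < cmod (a - b) / cmod (2 * of_real s + a + cnj b)"
    using \<open>a \<noteq> b\<close> by (intro divide_pos_pos) simp_all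
  define K where "K e = (s + Re e) * ((1 + cmod (of_real s - e - 1)) / s)\<^sup>2" for e
  have K_le: "K e * (1 - (cmod z)\<^sup>2) \<le> max (K a) (K b) * (1 - (cmod z)\<^sup>2)" if "e \<in> {a, b}" "cmod z < 1" for e z
    using that one_minus_norm_square_pos[OF that(2)] by (intro mult_right_mono) auto
  show ?thesis
  proof (rule that[OF \<delta>])
    fix z assume z: "cmod z < 1" "Re (cayley \<zeta> z) = 1"
    note bound = one_minus_norm_square_horocycle_le[OF \<zeta> \<eta> s z, folded K_def]
    show "1 - (cmod (\<phi> z))\<^sup>2 \<le> max (K a) (K b) * (1 - (cmod z)\<^sup>2)"
      using bound[OF \<phi>_disc[OF z(1)] a[OF z(1)]] K_le[of a, OF _ z(1)] by simp
    show "1 - (cmod (\<psi> z))\<^sup>2 \<le> max (K a) (K b) * (1 - (cmod z)\<^sup>2)"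
      using bound[OF \<psi>_disc[OF z(1)] b[OF z(1)]] K_le[of b, OF _ z(1)] by simp
    show "pseudohyperbolic_dist (\<phi> z) (\<psi> z) = cmod (a - b) / cmod (2 * of_real s + a + cnj b)"
      using pseudohyperbolic_dist_horocycle[OF \<eta> \<phi>_disc \<psi>_disc z(2) a b] z(1) by blast
  qed
qed

theorem theorem3:
  fixes \<phi> \<psi> :: "complex \<Rightarrow> complex" and \<zeta> :: complex
  assumes "lf_selfmap \<phi>" and "lf_selfmap \<psi>"
    and "\<not> disc_automorphism \<phi>" and "\<not> disc_automorphism \<psi>"
    and "cmod \<zeta> = 1"
    and "\<phi> \<zeta> = \<psi> \<zeta>" and "cmod (\<phi> \<zeta>) = 1"
    and "deriv \<phi> \<zeta> = deriv \<psi> \<zeta>"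
    and "\<exists>z\<in>ball 0 1. \<phi> z \<noteq> \<psi> z"
  shows "\<not> compact_op_on in_H2 H2_norm (\<lambda>f. comp_op \<phi> f - comp_op \<psi> f)
       \<and> (\<forall>\<alpha>::real. \<alpha> > -1 \<longrightarrow>
            \<not> compact_op_on (in_A2 \<alpha>) (A2_norm \<alpha>) (\<lambda>f. comp_op \<phi> f - comp_op \<psi> f))"
proof -
  note \<phi> = lf_selfmap_disc[OF \<open>lf_selfmap \<phi>\<close>] and \<psi> = lf_selfmap_disc[OF \<open>lf_selfmap \<psi>\<close>]
  obtain w where w: "\<And>k. cmod (w k) < 1" "\<And>k. Re (cayley \<zeta> (w k)) = 1" "(\<lambda>k. 1 - (cmod (w k))\<^sup>2) \<longlonglongrightarrow> 0"
    using horocycle_sequence[OF \<open>cmod \<zeta> = 1\<close>] by blast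
  obtain C \<delta> where "0 < \<delta>"
    and C: "\<And>k. 1 - (cmod (\<phi> (w k)))\<^sup>2 \<le> C * (1 - (cmod (w k))\<^sup>2)"
      "\<And>k. 1 - (cmod (\<psi> (w k)))\<^sup>2 \<le> C * (1 - (cmod (w k))\<^sup>2)"
    and \<delta>: "\<And>k. \<delta> \<le> pseudohyperbolic_dist (\<phi> (w k)) (\<psi> (w k))"
    using lf_selfmaps_separated_on_horocycle[OF assms(1,2,5-9)] w(1,2) by (metis order_refl)
  have "\<not> compact_op_on mem nrm (\<lambda>f. comp_op \<phi> f - comp_op \<psi> f)"
    if "weighted_hardy_space \<gamma> mem nrm" for \<gamma> mem nrm
    by (rule weighted_hardy_space.not_compact_comp_op_diff[OF that \<phi> \<psi> w(1,3) C \<open>0 < \<delta>\<close> \<delta>])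
  then show ?thesis using weighted_hardy_space_H2 weighted_hardy_space_A2 by blast
qed

end
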